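(* Let $\ell\ge 1$, let $q_1,\dots,q_\ell>2$ be pairwise co-prime natural numbers and let $k\ge 1$ be an integer. Let $\mathbf{K}\subset\mathbb{C}$ be a number field such that $$\mathbf{K}(\zeta_{\varphi(q_1)\cdots\varphi(q_\ell)})\cap \mathbb{Q}(\zeta_{q_1\cdots q_\ell})^{+}=\mathbb{Q}.$$ Then the numbers in the set $$X_{q_1,2k+1,o}\cup\cdots\cup X_{q_\ell,2k+1,o}$$ are linearly independent over $\mathbf{K}(\zeta_{\varphi(q_1)\cdots\varphi(q_\ell)})$.
   Context: For an integer $n\ge1$, $\zeta_n$ denotes a primitive $n$-th root of unity, $\varphi$ is Euler's totient function, and for $n>2$, $\mathbb{Q}(\zeta_n)^+=\mathbb{Q}(\zeta_n)\cap\mathbb{R}$ denotes the maximal real subfield of the $n$-th cyclotomic field. For a Dirichlet character $\chi$ modulo $q$ and $\Re(s)>1$, $L(s,\chi)=\sum_{n\ge1}\chi(n)n^{-s}$. For integers $q>2$, $m\ge1$, $X_{q,m,o}=\{L(m,\chi) : \chi \bmod q,\ \chi(-1)=-1\}$ is the set of values at $m$ of the $L$-functions of the odd Dirichlet characters modulo $q$ (characters not necessarily primitive). *)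

theory Defs
  imports Complex_Main "HOL-Number_Theory.Number_Theory"
begin

definition dirichlet_char :: "nat \<Rightarrow> (nat \<Rightarrow> complex) \<Rightarrow> bool" where
  "dirichlet_char q \<chi> \<longleftrightarrow>
     (\<forall>n. \<chi> (n + q) = \<chi> n) \<and>
     (\<forall>m n. \<chi> (m * n) = \<chi> m * \<chi> n) \<and>
     (\<forall>n. \<chi> n \<noteq> 0 \<longleftrightarrow> coprime n q)"

text \<open>Odd character: chi(-1) = -1, i.e. chi(q-1) = -1.\<close>
definition odd_char :: "nat \<Rightarrow> (nat \<Rightarrow> complex) \<Rightarrow> bool" where
  "odd_char q \<chi> \<longleftrightarrow> \<chi> (q - 1) = -1"

definition dirichlet_L :: "nat \<Rightarrow> (nat \<Rightarrow> complex) \<Rightarrow> complex" where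
  "dirichlet_L m \<chi> = (\<Sum>n. \<chi> (Suc n) / of_nat (Suc n) ^ m)"

definition X_odd :: "nat \<Rightarrow> nat \<Rightarrow> complex set" where
  "X_odd q m = {dirichlet_L m \<chi> | \<chi>. dirichlet_char q \<chi> \<and> odd_char q \<chi>}"

definition is_subfield :: "complex set \<Rightarrow> bool" where
  "is_subfield F \<longleftrightarrow> 0 \<in> F \<and> 1 \<in> F \<and>
     (\<forall>x\<in>F. \<forall>y\<in>F. x + y \<in> F \<and> x * y \<in> F) \<and>
     (\<forall>x\<in>F. - x \<in> F \<and> inverse x \<in> F)"

definition gen_field :: "complex set \<Rightarrow> complex set" where
  "gen_field S = \<Inter> {F. is_subfield F \<and> S \<subseteq> F}"

definition number_field :: "complex set \<Rightarrow> bool" where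
  "number_field K \<longleftrightarrow> is_subfield K \<and>
     (\<exists>B. finite B \<and> K \<subseteq> {\<Sum>b\<in>B. of_rat (c b) * b | c. True})"

definition zeta :: "nat \<Rightarrow> complex" where
  "zeta n = exp (2 * pi * \<i> / of_nat n)"

definition cyclo_plus :: "nat \<Rightarrow> complex set" where
  "cyclo_plus n = gen_field {zeta n} \<inter> \<real>"

definition lin_indep_over :: "complex set \<Rightarrow> complex set \<Rightarrow> bool" where
  "lin_indep_over F X \<longleftrightarrow>
     (\<forall>S c. finite S \<longrightarrow> S \<subseteq> X \<longrightarrow> (\<forall>s\<in>S. c s \<in> F) \<longrightarrow>
        (\<Sum>s\<in>S. c s * s) = 0 \<longrightarrow> (\<forall>s\<in>S. c s = 0))"

end

theory Submission
  imports Defs "HOL-Analysis.Gamma_Function" "Jordan_Normal_Form.Char_Poly"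
begin

text \<open>
  Write \<open>m = 2k+1\<close>, \<open>N = q\<^sub>1 \<cdots> q\<^sub>l\<close> and \<open>F\<close> for the coefficient field. Differentiating
  \<open>\<psi>(1-x) - \<psi>(x) = \<pi> cot \<pi>x\<close> shows that, for an odd character \<open>\<chi>\<close> modulo \<open>q\<close>,
  \<open>L(m,\<chi>) = C T\<^sub>\<chi>(\<zeta>\<^sub>q)\<close> with \<open>T\<^sub>\<chi>(x) = \<Sum>\<^sub>r \<chi>(r) R\<^sub>q(x\<^sup>r)\<close>, where \<open>R\<^sub>q\<close> is a rational polynomial and
  \<open>C \<noteq> 0\<close> depends on \<open>m\<close> only. A linear relation over \<open>F\<close> thus says that a polynomial \<open>P\<close> over \<open>F\<close>
  vanishes at \<open>\<zeta>\<^sub>N\<close>. As the characters are odd, \<open>P(x) = (x - x\<^sup>-\<^sup>1) g(x + x\<^sup>-\<^sup>1)\<close> on \<open>N\<close>-th roots of unity, for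
  some \<open>g\<close> over \<open>F\<close>, and since \<open>F\<close> meets the real cyclotomic field in the rationals, the conjugates
  of \<open>\<zeta>\<^sub>N + \<zeta>\<^sub>N\<^sup>-\<^sup>1\<close> over \<open>F\<close> are those over the rationals. So \<open>P(\<zeta>\<^sub>N\<^sup>b) = 0\<close> for all \<open>b\<close> coprime to \<open>N\<close>.
  But replacing \<open>\<zeta>\<^sub>q\<close> by \<open>\<zeta>\<^sub>q\<^sup>b\<close> multiplies \<open>T\<^sub>\<chi>\<close> by \<open>\<chi>(b)\<^sup>-\<^sup>1\<close>, so linear independence of characters
  isolates each coefficient times \<open>L(m,\<chi>)\<close>, and \<open>L(m,\<chi>) \<noteq> 0\<close> because \<open>\<bar>L(m,\<chi>) - 1\<bar> \<le> 1/2\<close>.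
\<close>

subsection \<open>Integral polynomials at roots of unity\<close>

text \<open>One notion for all coefficient domains that occur: the integers, the rationals, the
  field \<open>F\<close>, the ring Z[x], and the real cyclotomic field.\<close>

definition unital_subring :: "complex set \<Rightarrow> bool" where
  "unital_subring A \<longleftrightarrow> 0 \<in> A \<and> 1 \<in> A \<and>
     (\<forall>x\<in>A. \<forall>y\<in>A. x + y \<in> A \<and> x * y \<in> A) \<and> (\<forall>x\<in>A. - x \<in> A)"

text \<open>A set of complex polynomials rather than a polynomial type over each domain, so that
  polynomials over different subrings can be multiplied, evaluated and compared directly.\<close>

definition polys_over :: "complex set \<Rightarrow> complex poly set" where
  "polys_over A = {p. \<forall>i. coeff p i \<in> A}"

lemma unital_subring_Ints: "unital_subring \<int>"
  by (auto simp: unital_subring_def)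

lemma unital_subring_Rats: "unital_subring \<rat>"
  by (auto simp: unital_subring_def)

lemma is_subfield_imp_unital_subring: "is_subfield F \<Longrightarrow> unital_subring F"
  by (auto simp: unital_subring_def is_subfield_def)

context
  fixes A :: "complex set"
  assumes A: "unital_subring A"
begin

lemma unital_subring_sum: "(\<And>x. x \<in> I \<Longrightarrow> f x \<in> A) \<Longrightarrow> sum f I \<in> A"
  using A by (induction I rule: infinite_finite_induct) (auto simp: unital_subring_def)

lemma unital_subring_power: "x \<in> A \<Longrightarrow> x ^ n \<in> A"
  using A by (induction n) (auto simp: unital_subring_def)

lemma unital_subring_diff: "x \<in> A \<Longrightarrow> y \<in> A \<Longrightarrow> x - y \<in> A"
  using A by (metis unital_subring_def diff_conv_add_uminus)

lemma unital_subring_of_nat: "of_nat n \<in> A"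
  using A by (induction n) (auto simp: unital_subring_def)

lemma unital_subring_of_int: "of_int n \<in> A"
  using A unital_subring_of_nat by (cases n rule: int_cases2) (auto simp: unital_subring_def)

lemma unital_subring_poly:
  assumes "p \<in> polys_over A" "x \<in> A"
  shows "poly p x \<in> A"
proof -
  have "coeff p i * x ^ i \<in> A" for i
    using assms A unital_subring_power[of x i] by (auto simp: polys_over_def unital_subring_def)
  thus ?thesis unfolding poly_altdef by (intro unital_subring_sum)
qed

lemma polys_over_0: "0 \<in> polys_over A"
  using A by (auto simp: polys_over_def unital_subring_def)

lemma polys_over_pCons: "a \<in> A \<Longrightarrow> p \<in> polys_over A \<Longrightarrow> pCons a p \<in> polys_over A"
  by (auto simp: polys_over_def coeff_pCons split: nat.splits)

lemma polys_over_1: "1 \<in> polys_over A"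
  using A by (auto simp: one_pCons polys_over_0 unital_subring_def intro!: polys_over_pCons)

lemma polys_over_add: "p \<in> polys_over A \<Longrightarrow> r \<in> polys_over A \<Longrightarrow> p + r \<in> polys_over A"
  using A by (auto simp: polys_over_def unital_subring_def)

lemma polys_over_diff: "p \<in> polys_over A \<Longrightarrow> r \<in> polys_over A \<Longrightarrow> p - r \<in> polys_over A"
  using unital_subring_diff by (auto simp: polys_over_def)

lemma polys_over_mult: "p \<in> polys_over A \<Longrightarrow> r \<in> polys_over A \<Longrightarrow> p * r \<in> polys_over A"
  using A by (auto simp: polys_over_def Polynomial.coeff_mult unital_subring_def intro!: unital_subring_sum)

lemma polys_over_smult: "a \<in> A \<Longrightarrow> p \<in> polys_over A \<Longrightarrow> smult a p \<in> polys_over A"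
  using A by (auto simp: polys_over_def unital_subring_def)

lemma polys_over_power: "p \<in> polys_over A \<Longrightarrow> p ^ n \<in> polys_over A"
  by (induction n) (auto intro: polys_over_1 polys_over_mult)

lemma polys_over_sum: "(\<And>i. i \<in> I \<Longrightarrow> f i \<in> polys_over A) \<Longrightarrow> sum f I \<in> polys_over A"
  by (induction I rule: infinite_finite_induct) (auto intro: polys_over_0 polys_over_add)

lemma polys_over_prod: "(\<And>i. i \<in> I \<Longrightarrow> f i \<in> polys_over A) \<Longrightarrow> prod f I \<in> polys_over A"
  by (induction I rule: infinite_finite_induct) (auto intro: polys_over_1 polys_over_mult)

lemma polys_over_monom: "a \<in> A \<Longrightarrow> Polynomial.monom a n \<in> polys_over A"
  using A by (auto simp: polys_over_def unital_subring_def)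

lemma polys_over_pcompose:
  assumes "p \<in> polys_over A" "r \<in> polys_over A"
  shows "pcompose p r \<in> polys_over A"
  using assms(1)
proof (induction p)
  case 0
  show ?case by (simp add: polys_over_0)
next
  case (pCons a p)
  have "coeff (pCons a p) 0 \<in> A" "\<And>i. coeff (pCons a p) (Suc i) \<in> A"
    using pCons.prems unfolding polys_over_def by blast+
  hence "a \<in> A" "p \<in> polys_over A"
    by (auto simp: polys_over_def)
  thus ?case using pCons.IH assms(2)
    by (auto simp: pcompose_pCons polys_over_0 intro!: polys_over_add polys_over_mult polys_over_pCons)
qed

lemma polys_over_pderiv: "p \<in> polys_over A \<Longrightarrow> pderiv p \<in> polys_over A"
  using A unital_subring_of_nat unfolding unital_subring_def
  by (auto simp: polys_over_def coeff_pderiv simp del: of_nat_Suc)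

end

lemma polys_over_mono: "A \<subseteq> B \<Longrightarrow> polys_over A \<subseteq> polys_over B"
  by (auto simp: polys_over_def)

text \<open>The ring Z[x]. Divisibility by a prime \<open>p\<close> is tested inside this ring, by
  exhibiting a quotient in it.\<close>

definition adjoin_int :: "complex \<Rightarrow> complex set" where
  "adjoin_int x = (\<lambda>p. poly p x) ` polys_over \<int>"

lemma adjoin_intI: "p \<in> polys_over \<int> \<Longrightarrow> poly p x \<in> adjoin_int x"
  by (auto simp: adjoin_int_def)

lemma unital_subring_adjoin_int: "unital_subring (adjoin_int x)"
proof -
  note I = unital_subring_Ints
  have "0 \<in> adjoin_int x" "1 \<in> adjoin_int x"
    using adjoin_intI[OF polys_over_0[OF I], of x] adjoin_intI[OF polys_over_1[OF I], of x] by auto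
  moreover have "a + b \<in> adjoin_int x \<and> a * b \<in> adjoin_int x" if "a \<in> adjoin_int x" "b \<in> adjoin_int x" for a b
  proof -
    from that obtain p r where "p \<in> polys_over \<int>" "r \<in> polys_over \<int>" "a = poly p x" "b = poly r x"
      by (auto simp: adjoin_int_def)
    thus ?thesis
      using adjoin_intI[OF polys_over_add[OF I], of p r x] adjoin_intI[OF polys_over_mult[OF I], of p r x]
      by auto
  qed
  moreover have "-a \<in> adjoin_int x" if "a \<in> adjoin_int x" for a
  proof -
    from that obtain p where "p \<in> polys_over \<int>" "a = poly p x"
      by (auto simp: adjoin_int_def)
    thus ?thesis using adjoin_intI[OF polys_over_diff[OF I polys_over_0[OF I]], of p x] by auto
  qed
  ultimately show ?thesis by (auto simp: unital_subring_def)
qed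

lemma self_in_adjoin_int: "x \<in> adjoin_int x"
  using adjoin_intI[of "[:0, 1:]" x] polys_over_pCons[OF unital_subring_Ints]
    polys_over_0[OF unital_subring_Ints] by auto

lemma power_mod_root_of_unity:
  assumes "(x :: complex) ^ N = 1"
  shows "x ^ (n mod N) = x ^ n"
proof -
  have "x ^ n = x ^ (N * (n div N) + n mod N)" by simp
  also have "\<dots> = x ^ (n mod N)" by (simp only: power_add power_mult assms) simp
  finally show ?thesis by simp
qed

lemma power_cong_root_of_unity:
  assumes "(x :: complex) ^ N = 1" "[i = j] (mod N)"
  shows "x ^ i = x ^ j"
  using power_mod_root_of_unity[OF assms(1), of i] power_mod_root_of_unity[OF assms(1), of j] assms(2)
  by (simp add: Cong.cong_def)

text \<open>Multiplication by \<open>z\<close> maps the vector of powers of \<open>x\<close> to an integral matrix times that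
  vector, so \<open>z\<close> is a root of the characteristic polynomial of this matrix.\<close>

lemma algebraic_int_adjoin_root_of_unity:
  assumes x: "x ^ N = 1" "N > 0" and z: "z \<in> adjoin_int x"
  shows "algebraic_int z"
proof -
  from z obtain p where p: "p \<in> polys_over \<int>" "z = poly p x"
    by (auto simp: adjoin_int_def)
  obtain c :: "nat \<Rightarrow> int" where c: "coeff p j = of_int (c j)" for j
    using p unfolding polys_over_def Ints_def by (auto simp: image_iff) metis
  \<comment> \<open>As \<open>x ^ N = 1\<close>, \<open>z * x ^ i\<close> is the sum of the terms
    \<open>c j * x ^ ((i + j) mod N)\<close>. Entry \<open>(i, r)\<close> collects those with
    exponent \<open>r\<close>.\<close>
  define M where "M = mat N N (\<lambda>(i, r). \<Sum>j\<in>{j. j \<le> degree p \<and> (i + j) mod N = r}. c j)"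
  define B :: "complex mat" where "B = map_mat of_int M"
  define v where "v = vec N (\<lambda>i. x ^ i)"
  have M: "M \<in> carrier_mat N N" and B: "B \<in> carrier_mat N N"
    by (auto simp: M_def B_def)
  note xm = power_mod_root_of_unity[OF x(1)]
  have "B *\<^sub>v v = z \<cdot>\<^sub>v v"
  proof (rule eq_vecI)
    fix i assume "i < dim_vec (z \<cdot>\<^sub>v v)"
    hence i: "i < N" by (simp add: v_def)
    have "(B *\<^sub>v v) $ i = (\<Sum>r<N. of_int (\<Sum>j\<in>{j. j \<le> degree p \<and> (i + j) mod N = r}. c j) * x ^ r)"
      using i by (simp add: B_def M_def v_def scalar_prod_def lessThan_atLeast0)
    also have "\<dots> = (\<Sum>r<N. \<Sum>j\<in>{j\<in>{..degree p}. (i + j) mod N = r}. of_int (c j) * x ^ (i + j))"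
      by (intro sum.cong refl) (auto simp: sum_distrib_right xm intro!: sum.cong dest: sym)
    also have "\<dots> = (\<Sum>j\<le>degree p. of_int (c j) * x ^ (i + j))"
      using x by (intro sum.group) auto
    also have "\<dots> = z * x ^ i"
      by (simp add: p poly_altdef c sum_distrib_left power_add mult_ac)
    finally show "(B *\<^sub>v v) $ i = (z \<cdot>\<^sub>v v) $ i"
      using i by (simp add: v_def)
  qed (use B in \<open>auto simp: v_def\<close>)
  moreover have "v \<noteq> 0\<^sub>v N"
  proof
    assume "v = 0\<^sub>v N"
    hence "v $ 0 = 0\<^sub>v N $ 0" by simp
    thus False using x by (simp add: v_def)
  qed
  ultimately have "eigenvalue B z"
    unfolding eigenvalue_def eigenvector_def using B
    by (intro exI[of _ v]) (auto simp: v_def)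
  hence "poly (char_poly B) z = 0"
    using eigenvalue_root_char_poly[OF B] by simp
  moreover have cp: "char_poly B = map_poly of_int (char_poly M)"
    unfolding B_def by (rule of_int_hom.char_poly_hom[OF M])
  moreover have "lead_coeff (char_poly B) = 1"
    using degree_monic_char_poly[OF B] by simp
  ultimately show ?thesis
    by (intro algebraic_int.intros[of "char_poly B"]) (auto simp: coeff_map_poly)
qed

section \<open>Frobenius congruences and conjugation of roots of unity over the rationals\<close>

lemma fermat_little_int:
  assumes p: "prime (p :: nat)"
  shows "[(a :: int) ^ p = a] (mod int p)"
proof -
  have p0: "p > 0" using p by (simp add: prime_gt_0_nat)
  define r where "r = nat (a mod int p)"
  have ar: "[a = int r] (mod int p)" using p0 by (simp add: r_def Cong.cong_def)
  have "[r ^ p = r] (mod p)"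
  proof (cases "p dvd r")
    case True
    hence "p dvd r ^ p" using p0 by (meson dvd_power dvd_trans)
    thus ?thesis using True by (meson cong_0_iff cong_sym cong_trans)
  next
    case False
    hence "[r ^ (p - 1) * r = 1 * r] (mod p)"
      by (intro cong_mult cong_refl fermat_theorem p)
    thus ?thesis using p0 by (metis power_minus_mult mult_1)
  qed
  hence "[int r ^ p = int r] (mod int p)"
    by (metis cong_int_iff of_nat_power)
  thus ?thesis using ar by (meson cong_pow cong_sym cong_trans)
qed

text \<open>Modulo \<open>p\<close>, taking \<open>p\<close>-th powers is additive, since the inner
  binomial coefficients are divisible by \<open>p\<close>, and it fixes integers by Fermat.
  Induction on \<open>h\<close> combines the two and keeps the quotient \<open>w\<close> in
  Z[x].\<close>

lemma frobenius_congruence: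
  assumes p: "prime (p :: nat)" and h: "h \<in> polys_over \<int>"
  shows "\<exists>w\<in>adjoin_int x. poly h (x ^ p) = poly h x ^ p + of_nat p * w"
  using h
proof (induction h)
  case 0
  have "0 \<in> adjoin_int x" using unital_subring_adjoin_int by (simp add: unital_subring_def)
  thus ?case using prime_gt_0_nat[OF p] by (auto simp: zero_power)
next
  case (pCons a h)
  note R = unital_subring_adjoin_int[of x]
  have "coeff (pCons a h) 0 \<in> \<int>" "\<And>i. coeff (pCons a h) (Suc i) \<in> \<int>"
    using pCons.prems unfolding polys_over_def by blast+
  hence "a \<in> \<int>" and h: "h \<in> polys_over \<int>"
    by (auto simp: polys_over_def)
  then obtain a' where a: "a = of_int a'" by (auto elim: Ints_cases)
  from pCons.IH[OF h] obtain w where w: "w \<in> adjoin_int x" "poly h (x ^ p) = poly h x ^ p + of_nat p * w"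
    by blast
  have "[a' ^ p = a'] (mod int p)"
    by (rule fermat_little_int[OF p])
  then obtain t where t: "a' = a' ^ p + int p * t"
    by (metis cong_iff_lin)
  define y where "y = x * poly h x"
  have y: "y \<in> adjoin_int x" using R adjoin_intI[OF h, of x] self_in_adjoin_int[of x]
    by (auto simp: y_def unital_subring_def)
  \<comment> \<open>The inner binomial terms of \<open>(a + y) ^ p\<close>, divided by
    \<open>p\<close>; the division is exact because \<open>p\<close> is prime.\<close>
  define s where "s = (\<Sum>k\<in>{1..<p}. of_nat ((p choose k) div p) * (a ^ k * y ^ (p - k)))"
  have aR: "a \<in> adjoin_int x" unfolding a by (rule unital_subring_of_int[OF R])
  have s: "s \<in> adjoin_int x" unfolding s_def
    using R unital_subring_of_nat[OF R] unital_subring_power[OF R] aR y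
    by (intro unital_subring_sum[OF R]) (auto simp: unital_subring_def)
  have "(a + y) ^ p = (\<Sum>k\<le>p. of_nat (p choose k) * a ^ k * y ^ (p - k))"
    by (rule binomial_ring)
  also have "{..p} = insert 0 (insert p {1..<p})" using prime_gt_0_nat[OF p] by auto
  also have "(\<Sum>k\<in>\<dots>. of_nat (p choose k) * a ^ k * y ^ (p - k)) =
      y ^ p + a ^ p + (\<Sum>k\<in>{1..<p}. of_nat (p choose k) * a ^ k * y ^ (p - k))"
    using prime_gt_0_nat[OF p] by simp
  also have "(\<Sum>k\<in>{1..<p}. of_nat (p choose k) * a ^ k * y ^ (p - k)) = of_nat p * s"
    unfolding s_def sum_distrib_left
  proof (intro sum.cong refl)
    fix k assume "k \<in> {1..<p}"
    hence "p dvd (p choose k)" using p by (intro dvd_choose_prime) auto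
    hence "(p choose k) = p * ((p choose k) div p)" by simp
    hence "(of_nat (p choose k) :: complex) = of_nat p * of_nat ((p choose k) div p)"
      by (metis of_nat_mult)
    thus "of_nat (p choose k) * a ^ k * y ^ (p - k) =
      of_nat p * (of_nat ((p choose k) div p) * (a ^ k * y ^ (p - k)))" by simp
  qed
  finally have 1: "(a + y) ^ p = y ^ p + a ^ p + of_nat p * s" .
  have 2: "a = a ^ p + of_nat p * of_int t"
  proof -
    have "(of_int a' :: complex) = of_int (a' ^ p + int p * t)" using t by simp
    thus ?thesis unfolding a by simp
  qed
  have "poly (pCons a h) (x ^ p) = a + x ^ p * (poly h x ^ p + of_nat p * w)"
    by (simp add: w)
  also have "\<dots> = a ^ p + of_nat p * of_int t + y ^ p + of_nat p * (x ^ p * w)"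
    using 2 by (simp add: y_def algebra_simps power_mult_distrib)
  also have "\<dots> = (a + y) ^ p + of_nat p * (of_int t + x ^ p * w - s)"
    by (simp add: 1 algebra_simps)
  finally have "poly (pCons a h) (x ^ p) = poly (pCons a h) x ^ p + of_nat p * (of_int t + x ^ p * w - s)"
    by (simp add: y_def)
  moreover have "x ^ p \<in> adjoin_int x" by (rule unital_subring_power[OF R self_in_adjoin_int])
  hence "of_int t + x ^ p * w - s \<in> adjoin_int x"
    using R s w unital_subring_of_int[OF R, of t] by (intro unital_subring_diff[OF R]) (auto simp: unital_subring_def)
  ultimately show ?case by blast
qed

text \<open>Let \<open>a\<close> be the nonzero constant term of an integral polynomial vanishing at
  \<open>y\<close>, so \<open>a = - y * u\<close> with \<open>u\<close> in Z[x]. If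
  \<open>y = p * w\<close>, then \<open>a / p = - w * u\<close> is rational and an algebraic
  integer, hence an integer, and \<open>p\<close> is at most the absolute value of
  \<open>a\<close>.\<close>

lemma finitely_many_prime_divisors_adjoin_int:
  assumes x: "x ^ N = 1" "N > 0" and y: "y \<in> adjoin_int x" "y \<noteq> 0"
  shows "\<exists>M. \<forall>p w. prime (p :: nat) \<longrightarrow> w \<in> adjoin_int x \<longrightarrow> y = of_nat p * w \<longrightarrow> p \<le> M"
proof -
  note R = unital_subring_adjoin_int[of x]
  have "algebraic y" using algebraic_int_adjoin_root_of_unity[OF x y(1)] by auto
  then obtain f where f: "coeff f 0 \<noteq> 0" "poly (map_poly of_int f) y = 0"
    using algebraicE'_nonzero y(2) by blast
  obtain a g where fg: "f = pCons a g" by (cases f)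
  define u where "u = poly (map_poly of_int g) y"
  have "of_int a = - (y * u)"
    using f by (simp add: fg map_poly_pCons u_def add_eq_0_iff)
  have "p \<le> nat \<bar>a\<bar>" if p: "prime p" "w \<in> adjoin_int x" "y = of_nat p * w" for p :: nat and w
  proof -
    have "u \<in> adjoin_int x" unfolding u_def
      using unital_subring_of_int[OF R] y(1)
      by (intro unital_subring_poly[OF R]) (auto simp: polys_over_def coeff_map_poly)
    hence "- (w * u) \<in> adjoin_int x" using R p by (auto simp: unital_subring_def)
    hence "algebraic_int (- (w * u))" by (rule algebraic_int_adjoin_root_of_unity[OF x])
    moreover have eq: "of_int a = of_nat p * (- (w * u))"
      using \<open>of_int a = - (y * u)\<close> p by simp
    hence "- (w * u) = of_int a / of_nat p"
      using prime_gt_0_nat[OF p(1)] by (simp add: field_simps)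
    hence "- (w * u) \<in> \<rat>" by simp
    ultimately have "- (w * u) \<in> \<int>" by (rule rational_algebraic_int_is_int)
    then obtain b where "- (w * u) = of_int b" by (rule Ints_cases)
    hence "(of_int a :: complex) = of_int (int p * b)" using eq by simp
    hence "a = int p * b" using of_int_eq_iff by blast
    moreover have "a \<noteq> 0" using f fg by simp
    ultimately have "int p \<le> \<bar>a\<bar>" by (intro zdvd_imp_le) auto
    thus ?thesis by linarith
  qed
  thus ?thesis by blast
qed

text \<open>Add to \<open>b\<close> the multiple of \<open>N\<close> by all primes up to
  \<open>M\<close> that do not divide \<open>b\<close>. Every prime up to \<open>M\<close> then
  divides exactly one of the two summands, hence not the sum.\<close>

lemma coprime_residue_with_large_prime_factors:
  assumes "coprime b N" "N > 0"
  shows "\<exists>m>0. [m = b] (mod N) \<and> (\<forall>p. prime p \<longrightarrow> p dvd m \<longrightarrow> p > (M :: nat))"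
proof -
  define P where "P = {p. prime p \<and> p \<le> M \<and> \<not> p dvd b}"
  have "finite P" by (auto simp: P_def)
  define m where "m = b + N * \<Prod>P"
  have "\<Prod>P > 0" by (intro prod_pos) (auto simp: P_def prime_gt_0_nat)
  hence "m > 0" using assms by (simp add: m_def)
  moreover have "[m = b] (mod N)" by (simp add: m_def Cong.cong_def)
  moreover have "p > M" if p: "prime p" "p dvd m" for p
  proof (rule ccontr)
    assume "\<not> p > M"
    hence pM: "p \<le> M" by simp
    show False
    proof (cases "p dvd b")
      case True
      hence "p dvd N * \<Prod>P" using p(2) by (simp add: m_def dvd_add_right_iff)
      moreover have "\<not> p dvd N" using True assms p(1) by (metis coprime_common_divisor not_prime_unit)
      ultimately have "p dvd \<Prod>P" using p by (simp add: prime_dvd_mult_iff)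
      then obtain r where "r \<in> P" "p dvd r" using p \<open>finite P\<close> by (auto simp: prime_dvd_prod_iff)
      hence "p = r" using p by (auto simp: P_def primes_dvd_imp_eq)
      thus False using \<open>r \<in> P\<close> True by (simp add: P_def)
    next
      case False
      hence "p \<in> P" using p pM by (simp add: P_def)
      hence "p dvd N * \<Prod>P" using \<open>finite P\<close> by (metis dvd_prod_eqI dvd_mult)
      thus False using p(2) False by (simp add: m_def dvd_add_left_iff)
    qed
  qed
  ultimately show ?thesis by blast
qed

text \<open>Landau's argument: for a large prime \<open>p\<close>, \<open>h(x\<^sup>p)\<close> lies in a finite set and is
  divisible by \<open>p\<close>, hence vanishes.\<close>

lemma poly_int_root_of_unity_conjugate:
  assumes x: "x ^ N = 1" "N > 0" and h: "h \<in> polys_over \<int>" "poly h x = 0" and b: "coprime b N"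
  shows "poly h (x ^ b) = 0"
proof -
  note R = unital_subring_adjoin_int[of x]
  define V where "V = (\<lambda>j. poly h (x ^ j)) ` {..<N} - {0}"
  have mem: "poly h (x ^ j) \<in> adjoin_int x" for j
    using h unital_subring_of_int[OF R]
    by (intro unital_subring_poly[OF R] unital_subring_power[OF R] self_in_adjoin_int)
       (auto simp: polys_over_def elim!: Ints_cases, metis Ints_cases)
  have "\<exists>B. \<forall>p w. prime (p :: nat) \<longrightarrow> w \<in> adjoin_int x \<longrightarrow> y = of_nat p * w \<longrightarrow> p \<le> B" if "y \<in> V" for y
    using that mem by (intro finitely_many_prime_divisors_adjoin_int[OF x]) (auto simp: V_def)
  then obtain B where B: "\<And>y p w. y \<in> V \<Longrightarrow> prime (p :: nat) \<Longrightarrow> w \<in> adjoin_int x \<Longrightarrow> y = of_nat p * w \<Longrightarrow> p \<le> B y"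
    by metis
  \<comment> \<open>The nonzero values of \<open>h\<close> at powers of \<open>x\<close> form the
    finite set \<open>V\<close>, so one bound serves all: no prime above \<open>M\<close> divides a
    member of \<open>V\<close> in Z[x].\<close>
  define M where "M = (\<Sum>y\<in>V. B y)"
  have "finite V" by (simp add: V_def)
  have step: "poly h (x ^ (j * p)) = 0" if p: "prime p" "p > M" and j: "poly h (x ^ j) = 0" for p j
  proof (rule ccontr)
    assume nz: "poly h (x ^ (j * p)) \<noteq> 0"
    have "x ^ (j * p) = x ^ (j * p mod N)" by (simp add: power_mod_root_of_unity[OF x(1)])
    hence V: "poly h (x ^ (j * p)) \<in> V" using nz x by (auto simp: V_def)
    \<comment> \<open>The term \<open>poly h (x ^ j) ^ p\<close> vanishes by assumption, so the
      value at exponent \<open>j * p\<close> is \<open>p * w\<close>, with \<open>w\<close> in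
      Z[x^j] and thus in Z[x].\<close>
    obtain w where w: "w \<in> adjoin_int (x ^ j)" "poly h ((x ^ j) ^ p) = poly h (x ^ j) ^ p + of_nat p * w"
      using frobenius_congruence[OF p(1) h(1)] by blast
    have "w \<in> adjoin_int x"
    proof -
      from w obtain r where r: "r \<in> polys_over \<int>" "w = poly r (x ^ j)" by (auto simp: adjoin_int_def)
      show ?thesis unfolding r(2)
        using r(1) unital_subring_of_int[OF R]
        by (intro unital_subring_poly[OF R] unital_subring_power[OF R] self_in_adjoin_int)
           (auto simp: polys_over_def elim!: Ints_cases, metis Ints_cases)
    qed
    moreover have "poly h (x ^ (j * p)) = of_nat p * w"
      using w j prime_gt_0_nat[OF p(1)] by (simp add: power_mult zero_power)
    ultimately have "p \<le> B (poly h (x ^ (j * p)))" using B V p by blast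
    also have "\<dots> \<le> M" unfolding M_def using \<open>finite V\<close> V by (intro member_le_sum) auto
    finally show False using p by simp
  qed
  \<comment> \<open>The exponent \<open>m\<close> is built up from 1 by its prime factors, one
    application of \<open>step\<close> for each.\<close>
  have large: "poly h (x ^ m) = 0" if "m > 0" "\<forall>p. prime p \<longrightarrow> p dvd m \<longrightarrow> p > M" for m
    using that
  proof (induction m rule: less_induct)
    case (less m)
    show ?case
    proof (cases "m = 1")
      case True
      thus ?thesis using h by simp
    next
      case False
      then obtain p where p: "prime p" "p dvd m" using prime_factor_nat by blast
      then obtain j where j: "m = j * p" by (metis dvd_div_mult_self)
      have "j > 0" "j < m" using less.prems(1) j prime_gt_1_nat[OF p(1)] by auto
      hence "poly h (x ^ j) = 0" using less j by auto
      thus ?thesis using step[OF p(1), of j] less.prems p j by auto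
    qed
  qed
  obtain m where m: "m > 0" "[m = b] (mod N)" "\<forall>p. prime p \<longrightarrow> p dvd m \<longrightarrow> p > M"
    using coprime_residue_with_large_prime_factors[OF b x(2)] by blast
  thus ?thesis using large[of m] power_cong_root_of_unity[OF x(1) m(2)] by simp
qed

lemma clear_denominators:
  assumes "h \<in> polys_over \<rat>"
  shows "\<exists>d::int. d \<noteq> 0 \<and> smult (of_int d) h \<in> polys_over \<int>"
  using assms
proof (induction h)
  case 0
  show ?case by (rule exI[of _ 1]) (simp add: polys_over_0[OF unital_subring_Ints])
next
  case (pCons a h)
  note I = unital_subring_Ints
  have "coeff (pCons a h) 0 \<in> \<rat>" "\<And>i. coeff (pCons a h) (Suc i) \<in> \<rat>"
    using pCons.prems unfolding polys_over_def by blast+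
  hence a: "a \<in> \<rat>" and h: "h \<in> polys_over \<rat>"
    by (auto simp: polys_over_def)
  from pCons.IH[OF h] obtain d where d: "d \<noteq> 0" "smult (of_int d) h \<in> polys_over \<int>" by blast
  from a obtain u v where uv: "v > 0" "a = of_int u / of_int v" by (auto elim: Rats_cases')
  have "smult (of_int (v * d)) (pCons a h) = pCons (of_int (d * u)) (smult (of_int v) (smult (of_int d) h))"
    using uv by simp
  also have "\<dots> \<in> polys_over \<int>"
    by (intro polys_over_pCons[OF I] polys_over_smult[OF I] d) auto
  finally show ?case using uv d by (intro exI[of _ "v * d"]) auto
qed

corollary poly_rat_root_of_unity_conjugate:
  assumes x: "x ^ N = 1" "N > 0" and h: "h \<in> polys_over \<rat>" "poly h x = 0" and b: "coprime b N"
  shows "poly h (x ^ b) = 0"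
proof -
  obtain d :: int where d: "d \<noteq> 0" "smult (of_int d) h \<in> polys_over \<int>"
    using clear_denominators[OF h(1)] by blast
  show ?thesis using poly_int_root_of_unity_conjugate[OF x d(2) _ b] h(2) d(1) by simp
qed

subsection \<open>Conjugation over a field meeting the real cyclotomic field in the rationals\<close>

fun dickson :: "nat \<Rightarrow> complex poly" where
  "dickson 0 = [:2:]"
| "dickson (Suc 0) = [:0, 1:]"
| "dickson (Suc (Suc n)) = [:0, 1:] * dickson (Suc n) - dickson n"

text \<open>Dickson polynomials of the second kind, with the index shifted by one.\<close>

fun dickson2 :: "nat \<Rightarrow> complex poly" where
  "dickson2 0 = 0"
| "dickson2 (Suc 0) = 1"
| "dickson2 (Suc (Suc n)) = [:0, 1:] * dickson2 (Suc n) - dickson2 n"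

lemma poly_dickson: "x \<noteq> 0 \<Longrightarrow> poly (dickson n) (x + inverse x) = x ^ n + inverse x ^ n"
proof (induction n rule: dickson.induct)
  case (3 n)
  have inv: "x * (inverse x * t) = t" for t using 3 by simp
  show ?case using 3 by (simp add: algebra_simps inv)
qed auto

lemma poly_dickson2:
  "x \<noteq> 0 \<Longrightarrow> (x - inverse x) * poly (dickson2 n) (x + inverse x) = x ^ n - inverse x ^ n"
proof (induction n rule: dickson2.induct)
  case (3 n)
  have "(x - inverse x) * poly (dickson2 (Suc (Suc n))) (x + inverse x) =
    (x + inverse x) * ((x - inverse x) * poly (dickson2 (Suc n)) (x + inverse x)) -
    (x - inverse x) * poly (dickson2 n) (x + inverse x)"
    by (simp add: algebra_simps)
  also have "\<dots> = (x + inverse x) * (x ^ Suc n - inverse x ^ Suc n) - (x ^ n - inverse x ^ n)"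
    using 3 by simp
  also have "\<dots> = x ^ Suc (Suc n) - inverse x ^ Suc (Suc n)"
  proof -
    have inv: "x * (inverse x * t) = t" for t using 3 by simp
    show ?thesis by (simp add: algebra_simps inv)
  qed
  finally show ?case .
qed auto

lemma polys_over_X:
  assumes "unital_subring A"
  shows "[:0, 1:] \<in> polys_over A"
  using assms by (intro polys_over_pCons polys_over_0) (auto simp: unital_subring_def)

lemma dickson_polys_over: "unital_subring A \<Longrightarrow> dickson n \<in> polys_over A"
proof (induction n rule: dickson.induct)
  case 1
  thus ?case using unital_subring_of_nat[OF 1, of 2] by (auto intro!: polys_over_pCons polys_over_0)
qed (auto intro!: polys_over_diff polys_over_mult polys_over_X simp del: mult_pCons_left)

lemma dickson2_polys_over: "unital_subring A \<Longrightarrow> dickson2 n \<in> polys_over A"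
  by (induction n rule: dickson2.induct)
     (auto intro!: polys_over_0 polys_over_1 polys_over_diff polys_over_mult polys_over_X
       simp del: mult_pCons_left)

text \<open>\<open>p\<close> is a monic polynomial of least degree. The last property is the
  consequence of \<open>p\<close> dividing \<open>g\<close> that is needed: roots of
  \<open>p\<close> are roots of \<open>g\<close>. It is proved by division with remainder, carried
  out one leading term at a time.\<close>

lemma minimal_poly_exists:
  assumes F: "is_subfield F" and g0: "g0 \<in> polys_over F" "g0 \<noteq> 0" "poly g0 \<alpha> = 0"
  obtains p where "p \<in> polys_over F" "lead_coeff p = 1" "poly p \<alpha> = 0"
    "\<And>g \<beta>. g \<in> polys_over F \<Longrightarrow> poly g \<alpha> = 0 \<Longrightarrow> poly p \<beta> = 0 \<Longrightarrow> poly g \<beta> = 0"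
proof -
  note R = is_subfield_imp_unital_subring[OF F]
  define Q where "Q = (\<lambda>p. p \<in> polys_over F \<and> p \<noteq> 0 \<and> poly p \<alpha> = 0)"
  have "Q g0" using g0 by (simp add: Q_def)
  then obtain p0 where p0: "Q p0" "\<And>g. Q g \<Longrightarrow> degree p0 \<le> degree g"
    by (metis ex_has_least_nat)
  define p where "p = smult (inverse (lead_coeff p0)) p0"
  have lc: "inverse (lead_coeff p0) \<in> F"
    using p0(1) F by (auto simp: Q_def polys_over_def is_subfield_def)
  have p: "p \<in> polys_over F" "lead_coeff p = 1" "poly p \<alpha> = 0" "degree p = degree p0"
    using p0(1) lc by (auto simp: p_def Q_def intro!: polys_over_smult[OF R])
  have "poly g \<beta> = 0" if "g \<in> polys_over F" "poly g \<alpha> = 0" "poly p \<beta> = 0" for g \<beta>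
    using that
  proof (induction "degree g" arbitrary: g rule: less_induct)
    case less
    show ?case
    proof (cases "g = 0")
      case False
      hence le: "degree p \<le> degree g" using p0(2)[of g] less p by (simp add: Q_def)
      define g' where "g' = g - smult (lead_coeff g) (Polynomial.monom 1 (degree g - degree p) * p)"
      have "lead_coeff g \<in> F" using less.prems by (simp add: polys_over_def)
      moreover have "1 \<in> F" using F by (simp add: is_subfield_def)
      ultimately have g': "g' \<in> polys_over F" unfolding g'_def
        using less.prems p
        by (intro polys_over_diff[OF R] polys_over_smult[OF R] polys_over_mult[OF R] polys_over_monom[OF R]) auto
      have a: "poly g' \<alpha> = 0" using less.prems p by (simp add: g'_def)
      have b: "poly g' \<beta> = poly g \<beta>" using less.prems by (simp add: g'_def)
      show ?thesis
      \<comment> \<open>A nonzero constant cannot vanish at \<open>\<alpha>\<close>. In positive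
        degree, cancelling the leading term lowers the degree strictly.\<close>
      proof (cases "degree g = 0")
        case True
        with False less.prems show ?thesis by (auto elim!: degree_eq_zeroE)
      next
        case pos: False
        have "degree g' < degree g"
        proof (rule degree_lessI)
          have d: "degree (Polynomial.monom 1 (degree g - degree p) * p) \<le> degree g"
            by (rule order_trans[OF degree_mult_le]) (use le in \<open>simp add: degree_monom_eq\<close>)
          have c: "coeff (Polynomial.monom 1 (degree g - degree p) * p) (degree g) = 1"
            using le p(2) by (simp add: coeff_monom_mult)
          show "\<forall>k\<ge>degree g. coeff g' k = 0"
          proof (intro allI impI)
            fix k assume "k \<ge> degree g"
            show "coeff g' k = 0"
            proof (cases "k = degree g")
              case True
              thus ?thesis using c by (simp add: g'_def)
            next
              case False
              with \<open>k \<ge> degree g\<close> have "k > degree g" by simp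
              thus ?thesis using d by (simp add: g'_def coeff_eq_0)
            qed
          qed
        qed (use pos in auto)
        from less.hyps[OF this g' a less.prems(3)] b show ?thesis by simp
      qed
    qed auto
  qed
  with p that show ?thesis by blast
qed

section \<open>Generated fields and powers of \<open>zeta N\<close>\<close>

lemma is_subfield_gen_field: "is_subfield (gen_field S)"
  unfolding gen_field_def is_subfield_def by auto

lemma gen_field_superset: "S \<subseteq> gen_field S"
  by (auto simp: gen_field_def)

lemma zeta_power: "zeta N ^ j = exp (2 * of_real pi * \<i> * of_nat j / of_nat N)"
  by (simp add: zeta_def exp_of_nat_mult[symmetric] mult_ac)

lemma zeta_power_self [simp]: "N > 0 \<Longrightarrow> zeta N ^ N = 1"
  by (simp add: zeta_power)

lemma zeta_nonzero [simp]: "zeta N \<noteq> 0"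
  by (simp add: zeta_def)

lemma norm_zeta_power [simp]: "norm (zeta N ^ j) = 1"
  by (simp add: zeta_power)

lemma zeta_power_eq_1_iff: "N > 0 \<Longrightarrow> zeta N ^ j = 1 \<longleftrightarrow> N dvd j"
  using complex_root_unity_eq_1[of N j] by (simp add: zeta_power)

lemma root_of_unity_is_zeta_power:
  assumes "x ^ N = 1" "N > 0"
  obtains j where "x = zeta N ^ j"
  using complex_roots_unity[of N] assms by (auto simp: zeta_power)

text \<open>On the unit circle the inverse is the complex conjugate, so the sum is real.\<close>

lemma zeta_power_plus_inverse_in_cyclo_plus:
  "zeta N ^ j + inverse (zeta N ^ j) \<in> cyclo_plus N"
proof -
  have 1: "zeta N \<in> gen_field {zeta N}" using gen_field_superset by blast
  hence "zeta N ^ j \<in> gen_field {zeta N}"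
    by (intro unital_subring_power is_subfield_imp_unital_subring is_subfield_gen_field)
  hence "zeta N ^ j + inverse (zeta N ^ j) \<in> gen_field {zeta N}"
    using is_subfield_gen_field unfolding is_subfield_def by blast
  moreover have "inverse (zeta N ^ j) = cnj (zeta N ^ j)"
    using complex_norm_square[of "zeta N ^ j"] by (intro inverse_unique) (simp del: complex_cnj_power)
  hence "zeta N ^ j + inverse (zeta N ^ j) \<in> \<real>" by (simp add: complex_is_Real_iff del: complex_cnj_power)
  ultimately show ?thesis by (simp add: cyclo_plus_def)
qed

lemma unital_subring_cyclo_plus: "unital_subring (cyclo_plus N)"
  using is_subfield_imp_unital_subring[OF is_subfield_gen_field[of "{zeta N}"]]
  by (auto simp: cyclo_plus_def unital_subring_def)

lemma complex_eq_plus_inverse: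
  obtains x :: complex where "x \<noteq> 0" "y = x + inverse x"
proof -
  \<comment> \<open>A root of X^2 - y X + 1; the product of the two roots \<open>x\<close> and
    \<open>y - x\<close> is 1.\<close>
  define x where "x = (y + csqrt (y\<^sup>2 - 4)) / 2"
  have "2 * x - y = csqrt (y\<^sup>2 - 4)" by (simp add: x_def field_simps)
  hence "(2 * x - y)\<^sup>2 = y\<^sup>2 - 4" by simp
  hence "4 * (x * (y - x)) = 4 * 1" by (simp add: power2_eq_square algebra_simps)
  hence eq: "x * (y - x) = 1" by (subst (asm) mult_cancel_left) simp
  hence "x \<noteq> 0" by auto
  moreover have "inverse x = y - x" using eq by (rule inverse_unique)
  ultimately show ?thesis using that[of x] by simp
qed

text \<open>The minimal polynomial over \<open>F\<close> of \<open>\<zeta> + \<zeta>\<^sup>-\<^sup>1\<close> splits over the real subfield, so its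
  coefficients lie in the intersection and are rational.\<close>

lemma real_cyclotomic_conjugate:
  assumes F: "is_subfield F" and N: "N > 0" and int: "F \<inter> cyclo_plus N = \<rat>"
    and g: "g \<in> polys_over F" "poly g (zeta N + inverse (zeta N)) = 0" and b: "coprime b N"
  shows "poly g (zeta N ^ b + inverse (zeta N ^ b)) = 0"
proof -
  define z where "z = zeta N"
  have z: "z ^ N = 1" "z \<noteq> 0" using N by (auto simp: z_def)
  note R = is_subfield_imp_unital_subring[OF F]
  \<comment> \<open>At \<open>x + inverse x\<close> the value of \<open>h\<close> is
    \<open>(x ^ N - 1)\<^sup>2 / x ^ N\<close>. So its roots are exactly the sums
    \<open>x + inverse x\<close> with \<open>x ^ N = 1\<close>, all of which lie in
    \<open>cyclo_plus N\<close>.\<close>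
  define h where "h = dickson N - [:2:]"
  have h: "h \<in> polys_over F"
    unfolding h_def using unital_subring_of_nat[OF R, of 2]
    by (intro polys_over_diff[OF R] dickson_polys_over[OF R] polys_over_pCons[OF R] polys_over_0[OF R]) auto
  have ph: "poly h (x + inverse x) = x ^ N + inverse x ^ N - 2" if "x \<noteq> 0" for x
    using that by (simp add: h_def poly_dickson)
  have "poly h (2 + inverse 2) \<noteq> 0"
  proof -
    have "(2::complex) ^ N + inverse 2 ^ N - 2 = (2 ^ N - 1)\<^sup>2 / 2 ^ N"
      by (simp add: power2_eq_square field_simps)
    moreover have "(2::complex) ^ N \<noteq> 1"
    proof
      assume "(2::complex) ^ N = 1"
      hence "norm ((2::complex) ^ N) = 1" by simp
      hence "(2::real) ^ N = 1" by (simp add: norm_power)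
      thus False using one_less_power[of "2::real" N] N by simp
    qed
    ultimately show ?thesis by (subst ph) auto
  qed
  hence "h \<noteq> 0" by auto
  moreover have hz: "poly h (z + inverse z) = 0" using z by (simp add: ph power_inverse)
  ultimately obtain p where p: "p \<in> polys_over F" "lead_coeff p = 1" "poly p (z + inverse z) = 0"
    "\<And>g \<beta>. g \<in> polys_over F \<Longrightarrow> poly g (z + inverse z) = 0 \<Longrightarrow> poly p \<beta> = 0 \<Longrightarrow> poly g \<beta> = 0"
    using minimal_poly_exists[OF F h] by blast
  have root: "\<beta> \<in> cyclo_plus N" if "poly p \<beta> = 0" for \<beta>
  proof -
    obtain x where x: "x \<noteq> 0" "\<beta> = x + inverse x" by (rule complex_eq_plus_inverse)
    have "poly h \<beta> = 0" using p(4)[OF h hz that] .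
    hence "x ^ N + inverse x ^ N - 2 = 0" using x ph by simp
    hence "(x ^ N - 1) * (x ^ N - 1) = 0" using x by (simp add: power_inverse field_simps power2_eq_square)
    hence "x ^ N = 1" by simp
    thus ?thesis using x N zeta_power_plus_inverse_in_cyclo_plus by (metis root_of_unity_is_zeta_power)
  qed
  note E = unital_subring_cyclo_plus[of N]
  have "p = (\<Prod>\<beta>|poly p \<beta> = 0. [:-\<beta>, 1:] ^ order \<beta> p)"
    using complex_poly_decompose[of p] p(2) by simp
  also have "\<dots> \<in> polys_over (cyclo_plus N)"
    using root E
    by (intro polys_over_prod[OF E] polys_over_power[OF E] polys_over_pCons[OF E] polys_over_0[OF E])
       (auto simp: unital_subring_def)
  finally have pQ: "p \<in> polys_over \<rat>" using p(1) int by (auto simp: polys_over_def)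
  note Q = unital_subring_Rats
  \<comment> \<open>On \<open>N\<close>-th roots of unity \<open>x ^ (N - 1)\<close> is the inverse,
    so \<open>r\<close> is a rational polynomial in \<open>x\<close> itself with the value of
    \<open>p\<close> at \<open>x + inverse x\<close>. This makes conjugation over the rationals
    applicable.\<close>
  define r where "r = pcompose p ([:0, 1:] + Polynomial.monom 1 (N - 1))"
  have r: "r \<in> polys_over \<rat>" unfolding r_def
    by (intro polys_over_pcompose[OF Q] pQ polys_over_add[OF Q] polys_over_X[OF Q] polys_over_monom[OF Q]) simp
  have pr: "poly r x = poly p (x + inverse x)" if "x ^ N = 1" for x
  proof -
    have "x * x ^ (N - 1) = 1" using that N by (metis power_eq_if less_irrefl)
    hence "inverse x = x ^ (N - 1)" by (rule inverse_unique)
    thus ?thesis by (simp add: r_def poly_pcompose poly_monom)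
  qed
  have "poly r z = 0" using pr z p by simp
  hence "poly r (z ^ b) = 0" by (intro poly_rat_root_of_unity_conjugate[OF z(1) N r _ b])
  moreover have "(z ^ b) ^ N = 1" using z by (metis power_commutes power_mult mult.commute power_one)
  ultimately have "poly p (z ^ b + inverse (z ^ b)) = 0" using pr by simp
  thus ?thesis using p(4) g by (simp add: z_def)
qed

text \<open>The hypothesis on \<open>F\<close> controls only the real subfield. Oddness moves the
  problem there: \<open>2 * P(x) = P(x) - P(inverse x)\<close> is \<open>x - inverse x\<close> times
  a polynomial \<open>g\<close> over \<open>F\<close> in \<open>x + inverse x\<close>, term by term
  through \<open>dickson2\<close>.\<close>

lemma odd_cyclotomic_conjugate:
  assumes F: "is_subfield F" and N: "N > 2" and int: "F \<inter> cyclo_plus N = \<rat>"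
    and P: "P \<in> polys_over F" "poly P (zeta N) = 0" and b: "coprime b N"
    and odd: "\<And>x. x ^ N = 1 \<Longrightarrow> poly P (inverse x) = - poly P x"
  shows "poly P (zeta N ^ b) = 0"
proof -
  note R = is_subfield_imp_unital_subring[OF F]
  define g where "g = (\<Sum>j\<le>degree P. smult (coeff P j) (dickson2 j))"
  have g: "g \<in> polys_over F" unfolding g_def using P(1)
    by (intro polys_over_sum[OF R] polys_over_smult[OF R] dickson2_polys_over[OF R]) (auto simp: polys_over_def)
  have key: "2 * poly P x = (x - inverse x) * poly g (x + inverse x)" if x: "x ^ N = 1" for x
  proof -
    have x0: "x \<noteq> 0" using x N by (auto simp: zero_power)
    have "2 * poly P x = poly P x - poly P (inverse x)" using odd[OF x] by simp
    also have "\<dots> = (\<Sum>j\<le>degree P. coeff P j * (x ^ j - inverse x ^ j))"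
      by (simp add: poly_altdef sum_subtractf[symmetric] algebra_simps)
    also have "\<dots> = (\<Sum>j\<le>degree P. coeff P j * ((x - inverse x) * poly (dickson2 j) (x + inverse x)))"
      by (simp add: poly_dickson2[OF x0])
    also have "\<dots> = (x - inverse x) * poly g (x + inverse x)"
      by (simp add: g_def poly_sum sum_distrib_left mult_ac)
    finally show ?thesis .
  qed
  have zN: "zeta N ^ N = 1" using N by simp
  \<comment> \<open>For \<open>N > 2\<close> the factor \<open>zeta N - inverse (zeta N)\<close> is
    nonzero, so the zero of \<open>P\<close> is a zero of \<open>g\<close>.\<close>
  have "\<not> N dvd 2" using N by (auto dest: dvd_imp_le)
  hence "zeta N ^ 2 \<noteq> 1" using N by (subst zeta_power_eq_1_iff) auto
  hence "zeta N - inverse (zeta N) \<noteq> 0" by (auto simp: power2_eq_square field_simps)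
  with key[OF zN] P(2) have "poly g (zeta N + inverse (zeta N)) = 0" by simp
  hence "poly g (zeta N ^ b + inverse (zeta N ^ b)) = 0"
    using N by (intro real_cyclotomic_conjugate[OF F _ int g _ b]) auto
  moreover have "(zeta N ^ b) ^ N = 1" using zN by (metis power_mult mult.commute power_one)
  ultimately show ?thesis using key[of "zeta N ^ b"] by simp
qed

subsection \<open>Values of L-functions of odd characters at odd integers\<close>

text \<open>\<open>icot x\<close> below is \<open>\<i> cot (\<pi>x)\<close>, whose \<open>n\<close>-th derivative is \<open>(\<i>\<pi>)\<^sup>n\<close> times this polynomial in it.\<close>

primrec cot_deriv_poly :: "nat \<Rightarrow> complex poly" where
  "cot_deriv_poly 0 = [:0, 1:]"
| "cot_deriv_poly (Suc n) = [:-1, 0, 1:] * pderiv (cot_deriv_poly n)"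

definition icot :: "complex \<Rightarrow> complex" where
  "icot x = (1 + exp (2 * of_real pi * \<i> * x)) / (1 - exp (2 * of_real pi * \<i> * x))"

lemma exp_2pi_i_eq_1_iff: "exp (2 * of_real pi * \<i> * x) = 1 \<longleftrightarrow> x \<in> \<int>"
proof
  assume "exp (2 * of_real pi * \<i> * x) = 1"
  then obtain n :: int where n: "Im (2 * of_real pi * \<i> * x) = of_int (2 * n) * pi"
    and "Re (2 * of_real pi * \<i> * x) = 0"
    unfolding exp_eq_1 by blast
  hence "Re x = of_int n" "Im x = 0" by auto
  hence "x = of_int n" by (simp add: complex_eq_iff)
  thus "x \<in> \<int>" by simp
next
  assume "x \<in> \<int>"
  then obtain n where "x = of_int n" by (auto elim: Ints_cases)
  thus "exp (2 * of_real pi * \<i> * x) = 1"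
    by (auto simp: exp_eq_1)
qed

lemma has_field_derivative_icot:
  assumes "x \<notin> \<int>"
  shows "(icot has_field_derivative \<i> * of_real pi * ((icot x)\<^sup>2 - 1)) (at x)"
proof -
  define e where "e = exp (2 * of_real pi * \<i> * x)"
  have e: "1 - e \<noteq> 0" using assms exp_2pi_i_eq_1_iff[of x] by (auto simp: e_def)
  have "(icot has_field_derivative
     (2 * of_real pi * \<i> * e * (1 - e) - (1 + e) * (- (2 * of_real pi * \<i> * e))) / ((1 - e) * (1 - e))) (at x)"
    unfolding icot_def[abs_def] using e
    by (auto intro!: derivative_eq_intros simp: e_def)
  also have "(2 * of_real pi * \<i> * e * (1 - e) - (1 + e) * (- (2 * of_real pi * \<i> * e))) / ((1 - e) * (1 - e)) =
      \<i> * of_real pi * ((icot x)\<^sup>2 - 1)"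
    unfolding icot_def e_def[symmetric] using e
    by (simp add: power_divide divide_simps) (simp add: power2_eq_square algebra_simps)
  finally show ?thesis .
qed

text \<open>Logarithmic derivative of the constant function
  \<open>Gamma x * Gamma (1 - x) * sin (pi * x)\<close>; the cotangent is then rewritten in
  exponentials.\<close>

lemma Digamma_reflection:
  assumes x: "(x :: complex) \<notin> \<int>"
  shows "Digamma (1 - x) - Digamma x = - (\<i> * of_real pi * icot x)"
proof -
  have npos: "y \<notin> \<int>\<^sub>\<le>\<^sub>0" "1 - y \<notin> \<int>\<^sub>\<le>\<^sub>0" if "y \<notin> \<int>" for y :: complex
    using that nonpos_Ints_subset_Ints by (auto dest: Ints_diff[of 1 "1 - y"])
  define G where "G = Gamma x * Gamma (1 - x)"
  have G0: "G \<noteq> 0" using npos[OF x] by (simp add: G_def Gamma_eq_zero_iff)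
  have refl: "Gamma y * Gamma (1 - y) * sin (of_real pi * y) = of_real pi" if "y \<notin> \<int>" for y :: complex
  proof -
    have "Gamma y * Gamma (1 - y) \<noteq> 0" using npos[OF that] by (simp add: Gamma_eq_zero_iff)
    hence "sin (of_real pi * y) \<noteq> 0" using Gamma_reflection_complex[of y] by auto
    thus ?thesis using Gamma_reflection_complex[of y] by (simp add: field_simps)
  qed
  have "((\<lambda>y. Gamma y * Gamma (1 - y) * sin (of_real pi * y)) has_field_derivative
     G * ((Digamma x - Digamma (1 - x)) * sin (of_real pi * x) + of_real pi * cos (of_real pi * x))) (at x)"
    using npos[OF x] by (auto intro!: derivative_eq_intros simp: G_def algebra_simps)
  moreover have "((\<lambda>y. Gamma y * Gamma (1 - y) * sin (of_real pi * y)) has_field_derivative 0) (at x)"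
    by (rule has_field_derivative_transform_within_open[where f = "\<lambda>_. of_real pi" and S = "- \<int>"])
       (use x refl in \<open>auto simp: open_Compl\<close>)
  ultimately have "G * ((Digamma x - Digamma (1 - x)) * sin (of_real pi * x) + of_real pi * cos (of_real pi * x)) = 0"
    by (rule DERIV_unique)
  hence "(Digamma x - Digamma (1 - x)) * sin (of_real pi * x) + of_real pi * cos (of_real pi * x) = 0"
    using G0 by (subst (asm) mult_eq_0_iff) simp
  hence eq: "(Digamma (1 - x) - Digamma x) * sin (of_real pi * x) = of_real pi * cos (of_real pi * x)"
    by (simp add: algebra_simps)
  define e where "e = exp (\<i> * (of_real pi * x))"
  have e0: "e \<noteq> 0" by (simp add: e_def)
  have e2: "exp (2 * of_real pi * \<i> * x) = e\<^sup>2"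
    by (simp add: e_def exp_double[symmetric] mult_ac)
  have "1 - e\<^sup>2 \<noteq> 0" using x exp_2pi_i_eq_1_iff[of x] e2 by auto
  have s: "sin (of_real pi * x) = (e - inverse e) / (2 * \<i>)" and c: "cos (of_real pi * x) = (e + inverse e) / 2"
    by (simp_all add: e_def sin_exp_eq cos_exp_eq exp_minus)
  define d where "d = Digamma (1 - x) - Digamma x"
  have "d * (e - inverse e) = \<i> * of_real pi * (e + inverse e)"
  proof -
    have cancel: "d * u = d * (u / v) * v" if "v \<noteq> 0" for u v using that by simp
    have "d * (e - inverse e) = d * ((e - inverse e) / (2 * \<i>)) * (2 * \<i>)"
      by (rule cancel) simp
    also have "\<dots> = of_real pi * ((e + inverse e) / 2) * (2 * \<i>)"
      using eq unfolding s c d_def[symmetric] by (simp only:)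
    finally show ?thesis by simp
  qed
  hence "d * (e - inverse e) * e = \<i> * of_real pi * (e + inverse e) * e" by simp
  hence "d * (1 - e\<^sup>2) = - (\<i> * of_real pi * (1 + e\<^sup>2))"
    using e0 by (simp add: algebra_simps power2_eq_square)
  hence "d = - (\<i> * of_real pi * icot x)"
    unfolding icot_def e2 using \<open>1 - e\<^sup>2 \<noteq> 0\<close> by (simp add: field_simps)
  thus ?thesis by (simp add: d_def)
qed

text \<open>Repeated differentiation of the digamma case. Each derivative of a function of
  \<open>1 - x\<close> contributes a sign, and the derivative of \<open>icot\<close> produces the
  factor \<open>icot\<^sup>2 - 1\<close> of the recursion for \<open>cot_deriv_poly\<close>.\<close>

lemma Polygamma_reflection:
  assumes "(x :: complex) \<notin> \<int>"
  shows "(-1) ^ n * Polygamma n (1 - x) - Polygamma n x =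
    - ((\<i> * of_real pi) ^ Suc n * poly (cot_deriv_poly n) (icot x))"
  using assms
proof (induction n arbitrary: x)
  case 0
  thus ?case using Digamma_reflection[OF 0] by simp
next
  case (Suc n)
  have npos: "x \<notin> \<int>\<^sub>\<le>\<^sub>0" "1 - x \<notin> \<int>\<^sub>\<le>\<^sub>0"
    using Suc.prems nonpos_Ints_subset_Ints by (auto dest: Ints_diff[of 1 "1 - x"])
  have "((\<lambda>x. (-1) ^ n * Polygamma n (1 - x) - Polygamma n x) has_field_derivative
     (-1) ^ Suc n * Polygamma (Suc n) (1 - x) - Polygamma (Suc n) x) (at x)"
    using npos by (auto intro!: derivative_eq_intros)
  moreover have "((\<lambda>x. - ((\<i> * of_real pi) ^ Suc n * poly (cot_deriv_poly n) (icot x))) has_field_derivative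
     - ((\<i> * of_real pi) ^ Suc (Suc n) * poly (cot_deriv_poly (Suc n)) (icot x))) (at x)"
    by (rule derivative_eq_intros has_field_derivative_icot[OF Suc.prems] DERIV_chain2[OF poly_DERIV] refl)+
       (simp add: algebra_simps power2_eq_square)
  hence "((\<lambda>x. (-1) ^ n * Polygamma n (1 - x) - Polygamma n x) has_field_derivative
     - ((\<i> * of_real pi) ^ Suc (Suc n) * poly (cot_deriv_poly (Suc n)) (icot x))) (at x)"
    by (rule has_field_derivative_transform_within_open[where S = "- \<int>"])
       (use Suc in \<open>auto simp: open_Compl\<close>)
  ultimately show ?case by (rule DERIV_unique)
qed

section \<open>Dirichlet characters modulo \<open>q\<close> and their L-values\<close>

context
  fixes q :: nat and chi :: "nat \<Rightarrow> complex"
  assumes char: "dirichlet_char q chi" and q: "q > 2"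
begin

lemma dirichlet_char_mult: "chi (m * n) = chi m * chi n"
  using char by (simp add: dirichlet_char_def)

lemma dirichlet_char_nonzero_iff: "chi n \<noteq> 0 \<longleftrightarrow> coprime n q"
  using char by (simp add: dirichlet_char_def)

lemma dirichlet_char_0: "chi 0 = 0"
  using dirichlet_char_nonzero_iff[of 0] q by auto

lemma dirichlet_char_1: "chi 1 = 1"
  using dirichlet_char_mult[of 1 1] dirichlet_char_nonzero_iff[of 1] by auto

lemma dirichlet_char_power: "chi (m ^ n) = chi m ^ n"
  using dirichlet_char_1 by (induction n) (auto simp: dirichlet_char_mult)

lemma dirichlet_char_add_mult: "chi (n + k * q) = chi n"
proof (induction k)
  case (Suc k)
  have "chi (n + Suc k * q) = chi (n + k * q + q)" by (simp add: algebra_simps)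
  also have "\<dots> = chi (n + k * q)" using char by (simp add: dirichlet_char_def)
  finally show ?case using Suc by simp
qed auto

lemma dirichlet_char_mod: "chi (n mod q) = chi n"
  using dirichlet_char_add_mult[of "n mod q" "n div q"] by simp

lemma dirichlet_char_cong: "[m = n] (mod q) \<Longrightarrow> chi m = chi n"
  using dirichlet_char_mod[of m] dirichlet_char_mod[of n] by (simp add: Cong.cong_def)

lemma dirichlet_char_power_totient: "coprime n q \<Longrightarrow> chi n ^ totient q = 1"
  using dirichlet_char_cong[OF euler_theorem[of n q]] dirichlet_char_1
  by (simp add: dirichlet_char_power)

lemma norm_dirichlet_char_le: "norm (chi n) \<le> 1"
proof (cases "coprime n q")
  case True
  have "norm (chi n) ^ totient q = 1"
    using dirichlet_char_power_totient[OF True] by (metis norm_one norm_power)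
  moreover have "totient q > 0" using q by simp
  ultimately show ?thesis by (metis norm_ge_zero one_less_power not_le less_irrefl)
next
  case False
  thus ?thesis using dirichlet_char_nonzero_iff[of n] by simp
qed

lemma summable_dirichlet_L:
  assumes "m \<ge> 2"
  shows "summable (\<lambda>n. chi n / of_nat n ^ m)"
proof (rule summable_comparison_test')
  show "summable (\<lambda>n. inverse (of_nat n ^ m) :: real)"
    using assms by (rule inverse_power_summable)
  show "norm (chi n / of_nat n ^ m) \<le> inverse (of_nat n ^ m)" for n
    using norm_dirichlet_char_le[of n] dirichlet_char_0
    by (simp add: norm_divide norm_power divide_simps)
qed

lemma dirichlet_L_nonzero:
  assumes m: "m \<ge> 3"
  shows "dirichlet_L m chi \<noteq> 0"
proof -
  define f where "f = (\<lambda>n. chi n / of_nat n ^ m)"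
  have sf: "summable f" using m summable_dirichlet_L[of m] by (simp add: f_def)
  have sf': "summable (\<lambda>n. f (n + k))" for k using sf by (simp add: summable_iff_shift)
  have "dirichlet_L m chi = (\<Sum>n. f (n + 1))" by (simp add: dirichlet_L_def f_def)
  also have "\<dots> = f 1 + (\<Sum>n. f (n + 2))"
    using suminf_split_head[OF sf'[of 1]] by (simp add: eval_nat_numeral)
  also have "f 1 = 1" using dirichlet_char_1 by (simp add: f_def)
  finally have L: "dirichlet_L m chi = 1 + (\<Sum>n. f (n + 2))" .
  \<comment> \<open>A telescoping majorant: \<open>t n = 1 / (2 * (n + 1) * (n + 2))\<close> is at
    least \<open>1 / (n + 2) ^ 3\<close>, and the total is 1/2.\<close>
  define t where "t = (\<lambda>n. (1 / 2) * (inverse (real (Suc n)) - inverse (real (Suc (Suc n)))))"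
  have "(\<lambda>n. inverse (real (Suc n)) - inverse (real (Suc (Suc n)))) sums (inverse (real (Suc 0)) - 0)"
    by (rule telescope_sums'[OF LIMSEQ_inverse_real_of_nat])
  from sums_mult[OF this, of "1 / 2"] have t: "t sums (1 / 2)" by (simp add: t_def)
  have ft: "norm (f (n + 2)) \<le> t n" for n
  proof -
    have "norm (f (n + 2)) \<le> inverse (real (n + 2) ^ m)"
      using norm_dirichlet_char_le[of "n + 2"]
      by (simp add: f_def norm_divide norm_power divide_simps flip: of_nat_Suc of_nat_add)
    also have "\<dots> \<le> inverse (real (n + 2) ^ 3)"
      using m by (intro le_imp_inverse_le power_increasing) auto
    also have "\<dots> \<le> t n"
    proof -
      have "t n = inverse (2 * (real n + 1) * (real n + 2))"
        by (simp add: t_def field_simps)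
      moreover have "2 * (real n + 1) * (real n + 2) \<le> (real n + 2) ^ 3"
      proof -
        have "2 * (real n + 1) \<le> (real n + 2)\<^sup>2" by (simp add: power2_eq_square algebra_simps)
        hence "2 * (real n + 1) * (real n + 2) \<le> (real n + 2)\<^sup>2 * (real n + 2)"
          by (rule mult_right_mono) simp
        thus ?thesis by (simp add: eval_nat_numeral mult_ac)
      qed
      hence "inverse ((real n + 2) ^ 3) \<le> inverse (2 * (real n + 1) * (real n + 2))"
        by (rule le_imp_inverse_le) simp
      moreover have "real (n + 2) = real n + 2" by simp
      ultimately show ?thesis by (simp only:)
    qed
    finally show ?thesis .
  qed
  have "summable (\<lambda>n. norm (f (n + 2)))"
    by (rule summable_comparison_test'[OF sums_summable[OF t]]) (use ft in auto)
  hence "norm (\<Sum>n. f (n + 2)) \<le> (\<Sum>n. norm (f (n + 2)))" by (rule summable_norm)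
  also have "\<dots> \<le> (\<Sum>n. t n)"
    by (intro suminf_le ft \<open>summable (\<lambda>n. norm (f (n + 2)))\<close> sums_summable[OF t])
  also have "\<dots> = 1 / 2" using t by (simp add: sums_iff)
  finally have "norm (\<Sum>n. f (n + 2)) < norm (- 1 :: complex)" by simp
  thus ?thesis unfolding L by (metis add_eq_0_iff less_irrefl)
qed

text \<open>Cut the series into blocks of length \<open>q\<close>. As \<open>chi\<close> is
  periodic, the residue class of \<open>r\<close> contributes a multiple of the series of
  \<open>1 / (r / q + k) ^ Suc n\<close> over \<open>k\<close>, which is a polygamma value.\<close>

lemma dirichlet_L_Polygamma:
  assumes n: "n > 0"
  shows "dirichlet_L (Suc n) chi = (\<Sum>r\<in>{1..<q}. chi r * ((-1) ^ Suc n * Polygamma n (of_nat r / of_nat q) /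
    (fact n * of_nat q ^ Suc n)))"
proof -
  \<comment> \<open>Indexed from 0 so that blocks start at multiples of \<open>q\<close>; the
    additional term \<open>f 0\<close> is 0.\<close>
  define f where "f = (\<lambda>k. chi k / of_nat k ^ Suc n)"
  have "summable f" using n summable_dirichlet_L[of "Suc n"] by (simp add: f_def)
  hence "f sums (\<Sum>k. f k)" by (rule summable_sums)
  moreover have "(\<Sum>k. f k) = dirichlet_L (Suc n) chi"
    using suminf_split_head[OF \<open>summable f\<close>] by (simp add: dirichlet_L_def f_def)
  ultimately have "(\<lambda>k. sum f {k * q..<k * q + q}) sums dirichlet_L (Suc n) chi"
    using q sums_group[of f "dirichlet_L (Suc n) chi" q] by simp
  moreover have "sum f {k * q..<k * q + q} =
      (\<Sum>r\<in>{1..<q}. chi r / of_nat q ^ Suc n * inverse ((of_nat r / of_nat q + of_nat k) ^ Suc n))" for k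
  proof -
    have "sum f {k * q..<k * q + q} = (\<Sum>r\<in>{0..<q}. f (r + k * q))"
      using sum.shift_bounds_nat_ivl[of f 0 "k * q" q] by (simp add: add.commute)
    also have "\<dots> = (\<Sum>r\<in>{1..<q}. f (r + k * q))"
      using q dirichlet_char_add_mult[of 0 k] dirichlet_char_0
      by (simp add: sum.atLeast_Suc_lessThan f_def)
    also have "\<dots> = (\<Sum>r\<in>{1..<q}. chi r / of_nat q ^ Suc n * inverse ((of_nat r / of_nat q + of_nat k) ^ Suc n))"
    proof (intro sum.cong refl)
      fix r assume "r \<in> {1..<q}"
      have "of_nat r / of_nat q + of_nat k = (of_nat (r + k * q) / of_nat q :: complex)"
        using q by (simp add: field_simps)
      thus "f (r + k * q) = chi r / of_nat q ^ Suc n * inverse ((of_nat r / of_nat q + of_nat k) ^ Suc n)"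
        using q by (simp add: f_def dirichlet_char_add_mult power_divide del: power_Suc of_nat_add of_nat_mult)
    qed
    finally show ?thesis .
  qed
  ultimately have 1: "(\<lambda>k. \<Sum>r\<in>{1..<q}. chi r / of_nat q ^ Suc n * inverse ((of_nat r / of_nat q + of_nat k) ^ Suc n))
    sums dirichlet_L (Suc n) chi" by simp
  have 2: "(\<lambda>k. \<Sum>r\<in>{1..<q}. chi r / of_nat q ^ Suc n * inverse ((of_nat r / of_nat q + of_nat k) ^ Suc n))
    sums (\<Sum>r\<in>{1..<q}. chi r / of_nat q ^ Suc n * ((-1) ^ Suc n * Polygamma n (of_nat r / of_nat q) / fact n))"
    by (intro sums_sum sums_mult Polygamma_LIMSEQ n) (use q in auto)
  from sums_unique2[OF 1 2] show ?thesis
    by (simp add: mult_ac)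
qed

text \<open>Multiplication by \<open>b\<close> permutes the residues modulo \<open>q\<close>.
  Applied to functions of \<open>x ^ r\<close>, this describes the effect of replacing a root of
  unity \<open>x\<close> by \<open>x ^ b\<close>.\<close>

lemma dirichlet_char_sum_mult:
  assumes b: "coprime b q" and g: "\<And>n. g (n mod q) = g n"
  shows "chi b * (\<Sum>r<q. chi r * g (b * r)) = (\<Sum>r<q. chi r * g r)"
proof -
  define \<pi> where "\<pi> = (\<lambda>r. b * r mod q)"
  have "inj_on \<pi> {..<q}"
  proof
    fix r s assume rs: "r \<in> {..<q}" "s \<in> {..<q}" "\<pi> r = \<pi> s"
    hence "[b * r = b * s] (mod q)" by (simp add: \<pi>_def Cong.cong_def)
    hence "[r = s] (mod q)" using b by (simp add: cong_mult_lcancel_nat)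
    thus "r = s" using rs by (simp add: Cong.cong_def)
  qed
  moreover have "\<pi> ` {..<q} \<subseteq> {..<q}" using q by (auto simp: \<pi>_def)
  ultimately have "\<pi> ` {..<q} = {..<q}" by (intro endo_inj_surj) auto
  hence "(\<Sum>r<q. chi r * g r) = (\<Sum>r\<in>\<pi> ` {..<q}. chi r * g r)" by simp
  also have "\<dots> = (\<Sum>r<q. chi (\<pi> r) * g (\<pi> r))"
    using \<open>inj_on \<pi> {..<q}\<close> by (simp add: sum.reindex)
  also have "\<dots> = (\<Sum>r<q. chi b * (chi r * g (b * r)))"
    by (simp add: \<pi>_def dirichlet_char_mod g dirichlet_char_mult mult_ac)
  finally show ?thesis by (simp add: sum_distrib_left)
qed

lemma odd_char_reflect:
  assumes "odd_char q chi" "r \<le> q" "r > 0"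
  shows "chi (q - r) = - chi r"
proof -
  have "(q - 1) * r = (q - r) + (r - 1) * q"
    using assms q by (auto simp: algebra_simps nat_diff_split le_Suc_ex)
  hence "chi (q - r) = chi ((q - 1) * r)" by (simp add: dirichlet_char_add_mult)
  thus ?thesis using assms by (simp add: dirichlet_char_mult odd_char_def)
qed

end

text \<open>For \<open>z\<^sup>q = 1\<close>, \<open>z \<noteq> 1\<close> the inverse of \<open>1 - z\<close> is \<open>-1/q \<Sum> j z\<^sup>j\<close>.\<close>

definition icot_poly :: "nat \<Rightarrow> complex poly" where
  "icot_poly q = smult (- 1 / of_nat q) ([:1, 1:] * (\<Sum>j<q. Polynomial.monom (of_nat j) j))"

text \<open>The factor \<open>1 / q ^ Suc n\<close> is included so that the constant in
  \<open>dirichlet_L_odd\<close> does not depend on \<open>q\<close> and is shared by characters of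
  different moduli.\<close>

definition L_poly :: "nat \<Rightarrow> nat \<Rightarrow> complex poly" where
  "L_poly n q = smult (1 / of_nat q ^ Suc n) (pcompose (cot_deriv_poly n) (icot_poly q))"

lemma poly_icot_poly:
  assumes z: "z ^ q = 1" "z \<noteq> 1" and q: "q > 0"
  shows "poly (icot_poly q) z = (1 + z) / (1 - z)"
proof -
  \<comment> \<open>Summation by parts. At \<open>n = q\<close> the geometric sum vanishes and
    \<open>- q\<close> remains.\<close>
  have "(1 - z) * (\<Sum>j<n. of_nat j * z ^ j) = (\<Sum>j<n. z ^ j) - 1 - (of_nat n - 1) * z ^ n" if "n > 0" for n
    using that
  proof (induction n rule: nat_induct_non_zero)
    case (Suc n)
    thus ?case by (simp add: algebra_simps)
  qed auto
  from this[OF q] have "(1 - z) * (\<Sum>j<q. of_nat j * z ^ j) = - of_nat q"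
    using z by (simp add: sum_gp_strict)
  hence S: "(\<Sum>j<q. of_nat j * z ^ j) = - of_nat q / (1 - z)"
    using z by (simp add: field_simps)
  have "poly (icot_poly q) z = - 1 / of_nat q * ((1 + z) * (\<Sum>j<q. of_nat j * z ^ j))"
    by (simp add: icot_poly_def poly_sum poly_monom algebra_simps)
  also have "\<dots> = (1 + z) / (1 - z)"
    unfolding S using q z by (simp add: divide_simps)
  finally show ?thesis .
qed

lemma L_poly_polys_over_Rats: "L_poly n q \<in> polys_over \<rat>"
proof -
  note Q = unital_subring_Rats
  have "cot_deriv_poly n \<in> polys_over \<rat>"
    by (induction n)
       (auto intro!: polys_over_X[OF Q] polys_over_mult[OF Q] polys_over_pderiv[OF Q] polys_over_pCons[OF Q]
         polys_over_0[OF Q] simp del: mult_pCons_left)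
  moreover have "icot_poly q \<in> polys_over \<rat>" unfolding icot_poly_def
    by (intro polys_over_smult[OF Q] polys_over_mult[OF Q] polys_over_sum[OF Q] polys_over_monom[OF Q]
        polys_over_pCons[OF Q] polys_over_0[OF Q]) auto
  ultimately show ?thesis unfolding L_poly_def
    by (intro polys_over_smult[OF Q] polys_over_pcompose[OF Q]) auto
qed

text \<open>Oddness pairs the residues \<open>r\<close> and \<open>q - r\<close>, so twice the
  polygamma sum becomes a sum of differences between \<open>1 - x\<close> and \<open>x\<close> at
  \<open>x = r / q\<close>. As \<open>n\<close> is even, the sign in
  \<open>Polygamma_reflection\<close> is positive and that formula evaluates them.\<close>

lemma dirichlet_L_odd:
  assumes char: "dirichlet_char q chi" "odd_char q chi" and q: "q > 2" and n: "even n" "n > 0"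
  shows "dirichlet_L (Suc n) chi =
    - ((\<i> * of_real pi) ^ Suc n / (2 * fact n)) * (\<Sum>r<q. chi r * poly (L_poly n q) (zeta q ^ r))"
proof -
  define \<Psi> where "\<Psi> = (\<lambda>r::nat. Polygamma n (of_nat r / of_nat q :: complex))"
  define A where "A = (\<Sum>r\<in>{1..<q}. chi r * \<Psi> r)"
  define T where "T = (\<Sum>r\<in>{1..<q}. chi r * poly (L_poly n q) (zeta q ^ r))"
  have L: "dirichlet_L (Suc n) chi = - A / (fact n * of_nat q ^ Suc n)"
    using n unfolding dirichlet_L_Polygamma[OF char(1) q n(2)] A_def \<Psi>_def
    by (simp add: sum_divide_distrib sum_negf del: power_Suc)
  have "(\<Sum>r\<in>{1..<q}. chi r * \<Psi> (q - r)) = (\<Sum>r\<in>{1..<q}. chi (q - r) * \<Psi> r)"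
    by (rule sum.reindex_bij_witness[of _ "\<lambda>r. q - r" "\<lambda>r. q - r"]) auto
  also have "\<dots> = - A" unfolding A_def sum_negf[symmetric]
    by (intro sum.cong refl) (simp add: odd_char_reflect[OF char(1) q char(2)])
  finally have "- 2 * A = (\<Sum>r\<in>{1..<q}. chi r * (\<Psi> (q - r) - \<Psi> r))"
    by (simp add: A_def algebra_simps sum_subtractf)
  also have "\<dots> = (\<Sum>r\<in>{1..<q}. - ((\<i> * of_real pi) ^ Suc n) * of_nat q ^ Suc n * (chi r * poly (L_poly n q) (zeta q ^ r)))"
  proof (intro sum.cong refl)
    fix r assume r: "r \<in> {1..<q}"
    define x where "x = (of_nat r / of_nat q :: complex)"
    have "1 - x = of_nat (q - r) / of_nat q"
      using r by (simp add: x_def of_nat_diff field_simps)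
    moreover have ex: "exp (2 * of_real pi * \<i> * x) = zeta q ^ r"
      by (simp add: zeta_power x_def)
    have z1: "zeta q ^ r \<noteq> 1" using r q by (auto simp: zeta_power_eq_1_iff dest: dvd_imp_le)
    hence "x \<notin> \<int>" using exp_2pi_i_eq_1_iff[of x] ex by simp
    ultimately have "\<Psi> (q - r) - \<Psi> r = - ((\<i> * of_real pi) ^ Suc n * poly (cot_deriv_poly n) (icot x))"
      using Polygamma_reflection[of x n] n by (simp add: \<Psi>_def x_def)
    moreover have "(zeta q ^ r) ^ q = 1" using q by (metis power_mult mult.commute power_one zeta_power_self
       gr_zeroI not_less0)
    hence "icot x = poly (icot_poly q) (zeta q ^ r)"
      using z1 q by (simp add: icot_def ex poly_icot_poly)
    ultimately show "chi r * (\<Psi> (q - r) - \<Psi> r) =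
       - ((\<i> * of_real pi) ^ Suc n) * of_nat q ^ Suc n * (chi r * poly (L_poly n q) (zeta q ^ r))"
      using q by (simp add: L_poly_def poly_pcompose del: power_Suc)
  qed
  also have "\<dots> = - ((\<i> * of_real pi) ^ Suc n) * of_nat q ^ Suc n * T"
    by (simp only: T_def sum_distrib_left)
  finally have "A = (\<i> * of_real pi) ^ Suc n * of_nat q ^ Suc n * T / 2"
    by (simp del: power_Suc add: field_simps)
  hence "dirichlet_L (Suc n) chi = - ((\<i> * of_real pi) ^ Suc n / (2 * fact n)) * T"
    using q by (simp add: L field_simps del: power_Suc)
  \<comment> \<open>Adding the term at 0, where \<open>chi\<close> vanishes, makes the sum run over
    all residues, as \<open>dirichlet_char_sum_mult\<close> requires.\<close>
  also have "T = (\<Sum>r<q. chi r * poly (L_poly n q) (zeta q ^ r))"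
    unfolding T_def lessThan_atLeast0 using q dirichlet_char_0[OF char(1) q]
    by (simp add: sum.atLeast_Suc_lessThan)
  finally show ?thesis .
qed

subsection \<open>Linear independence\<close>

text \<open>Dedekind's argument: subtracting \<open>\<phi> t c\<close> times the relation at
  \<open>b\<close> from the relation at \<open>c * b\<close> removes \<open>t\<close> and multiplies
  each other coefficient by \<open>\<phi> s c - \<phi> t c\<close>. Working on a subset
  \<open>G\<close> permits comparing characters of different moduli on the integers coprime to all
  moduli.\<close>

lemma linear_independence_of_characters:
  fixes \<phi> :: "'s \<Rightarrow> 'g::monoid_mult \<Rightarrow> 'a::field"
  assumes "finite S" "1 \<in> G" and closed: "\<And>a b. a \<in> G \<Longrightarrow> b \<in> G \<Longrightarrow> a * b \<in> G"
    and "\<And>s. s \<in> S \<Longrightarrow> \<phi> s 1 = 1"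
    and "\<And>s a b. s \<in> S \<Longrightarrow> a \<in> G \<Longrightarrow> b \<in> G \<Longrightarrow> \<phi> s (a * b) = \<phi> s a * \<phi> s b"
    and "\<And>s t. s \<in> S \<Longrightarrow> t \<in> S \<Longrightarrow> s \<noteq> t \<Longrightarrow> \<exists>b\<in>G. \<phi> s b \<noteq> \<phi> t b"
    and "\<And>b. b \<in> G \<Longrightarrow> (\<Sum>s\<in>S. a s * \<phi> s b) = 0"
  shows "\<forall>s\<in>S. a s = 0"
  using assms(1,4-)
proof (induction S arbitrary: a rule: finite_induct)
  case (insert t S)
  note one = insert.prems(1) and mult = insert.prems(2) and dist = insert.prems(3) and rel = insert.prems(4)
  have zero: "\<forall>s\<in>S. a s * (\<phi> s c - \<phi> t c) = 0" if c: "c \<in> G" for c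
  proof (rule insert.IH)
    fix b assume b: "b \<in> G"
    have "(\<Sum>s\<in>S. a s * (\<phi> s c - \<phi> t c) * \<phi> s b) =
       (\<Sum>s\<in>insert t S. a s * \<phi> s c * \<phi> s b - \<phi> t c * (a s * \<phi> s b))"
      using insert.hyps by (simp add: algebra_simps)
    also have "\<dots> = (\<Sum>s\<in>insert t S. a s * \<phi> s (c * b)) - \<phi> t c * (\<Sum>s\<in>insert t S. a s * \<phi> s b)"
      unfolding sum_subtractf sum_distrib_left
      by (intro arg_cong2[of _ _ _ _ "(-)"] sum.cong refl) (simp add: mult b c)
    also have "\<dots> = 0" using rel b c closed by simp
    finally show "(\<Sum>s\<in>S. a s * (\<phi> s c - \<phi> t c) * \<phi> s b) = 0" .
  qed (use one mult dist in auto)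
  have S: "\<forall>s\<in>S. a s = 0"
  proof
    fix s assume s: "s \<in> S"
    then obtain c where "c \<in> G" "\<phi> s c \<noteq> \<phi> t c" using dist[of s t] insert.hyps by auto
    thus "a s = 0" using zero[of c] s by auto
  qed
  moreover have "a t = 0" using rel[OF assms(2)] S insert.hyps one[of t] by simp
  ultimately show ?case by simp
qed auto

text \<open>Used to separate characters: \<open>b\<close> can be prescribed at one modulus while
  every character of another modulus takes the value 1 at it.\<close>

lemma crt_coprime_lift:
  fixes q :: "nat \<Rightarrow> nat"
  assumes I: "finite I" "i \<in> I" and cop: "\<forall>i\<in>I. \<forall>j\<in>I. i \<noteq> j \<longrightarrow> coprime (q i) (q j)"
    and a: "coprime a (q i)"
  shows "\<exists>b. coprime b (\<Prod>i\<in>I. q i) \<and> [b = a] (mod q i) \<and> (\<forall>j\<in>I - {i}. [b = 1] (mod q j))"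
proof -
  define M where "M = (\<Prod>j\<in>I - {i}. q j)"
  have qM: "coprime (q i) M" unfolding M_def using I cop by (intro prod_coprime_right) auto
  obtain b where b: "[b = a] (mod q i)" "[b = 1] (mod M)"
    using binary_chinese_remainder_nat[OF qM, of a 1] by auto
  have "coprime b (q i)" using cong_imp_coprime[OF cong_sym[OF b(1)] a] .
  moreover have "coprime b M" by (rule cong_imp_coprime[OF cong_sym[OF b(2)]]) simp
  moreover have "(\<Prod>i\<in>I. q i) = q i * M" using I by (simp add: M_def prod.remove)
  moreover have "[b = 1] (mod q j)" if "j \<in> I - {i}" for j
  proof -
    have "q j dvd M" unfolding M_def using that I by (intro dvd_prodI) auto
    thus ?thesis using b(2) cong_dvd_modulus_nat by blast
  qed
  ultimately show ?thesis using b(1) by auto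
qed

lemma zeta_power_div:
  assumes "d dvd N" "N > 0"
  shows "zeta N ^ (N div d) = zeta d"
proof -
  from assms obtain e where e: "N = d * e" by blast
  have "zeta N ^ e = zeta d"
    unfolding zeta_power zeta_def[of d] using assms(2) by (simp add: e field_simps)
  thus ?thesis using e assms by simp
qed

theorem theorem1p3:
  fixes l :: nat and q :: "nat \<Rightarrow> nat" and k :: nat and K :: "complex set"
  assumes "l \<ge> 1"
    and "\<forall>i\<in>{1..l}. q i > 2"
    and "\<forall>i\<in>{1..l}. \<forall>j\<in>{1..l}. i \<noteq> j \<longrightarrow> coprime (q i) (q j)"
    and "k \<ge> 1"
    and "number_field K"
    and "gen_field (K \<union> {zeta (\<Prod>i=1..l. totient (q i))}) \<inter> cyclo_plus (\<Prod>i=1..l. q i) = \<rat>"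
  shows "lin_indep_over (gen_field (K \<union> {zeta (\<Prod>i=1..l. totient (q i))}))
           (\<Union>i\<in>{1..l}. X_odd (q i) (2 * k + 1))"
proof -
  define I where "I = {1..l}"
  define N where "N = (\<Prod>i\<in>I. q i)"
  define M where "M = (\<Prod>i\<in>I. totient (q i))"
  define F where "F = gen_field (K \<union> {zeta M})"
  define n where "n = 2 * k"
  have n: "even n" "n > 0" "Suc n \<ge> 3" using assms(4) by (auto simp: n_def)
  have q: "q i > 2" if "i \<in> I" for i using assms(2) that by (simp add: I_def)
  have cop: "\<forall>i\<in>I. \<forall>j\<in>I. i \<noteq> j \<longrightarrow> coprime (q i) (q j)" using assms(3) by (simp add: I_def)
  have finI: "finite I" by (simp add: I_def)
  have int: "F \<inter> cyclo_plus N = \<rat>" using assms(6) by (simp add: F_def N_def M_def I_def)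
  have F: "is_subfield F" unfolding F_def by (rule is_subfield_gen_field)
  note R = is_subfield_imp_unital_subring[OF F]
  have N0: "N > 0" unfolding N_def using q by (intro prod_pos) (metis gr_zeroI not_less0)
  have M0: "M > 0" unfolding M_def using q by (intro prod_pos) (metis gr_zeroI not_less0 totient_gt_0_iff)
  have qN: "q i dvd N" if "i \<in> I" for i unfolding N_def using finI that by (intro dvd_prodI)
  have N2: "N > 2"
    using q[of 1] qN[of 1] assms(1) N0 by (auto simp: I_def dest!: dvd_imp_le)
  have zM: "zeta M \<in> F" unfolding F_def using gen_field_superset by blast
  \<comment> \<open>Nonzero values are roots of unity of order dividing
    \<open>totient (q i)\<close>, hence powers of \<open>zeta M\<close>. This is why that root of
    unity is adjoined.\<close>
  have char_in_F: "chi r \<in> F" if "i \<in> I" "dirichlet_char (q i) chi" for i chi r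
  proof (cases "coprime r (q i)")
    case True
    have "totient (q i) dvd M" unfolding M_def using finI that(1) by (intro dvd_prodI)
    moreover have "chi r ^ totient (q i) = 1"
      using dirichlet_char_power_totient[OF that(2) q[OF that(1)] True] .
    ultimately have "chi r ^ M = 1" by (metis dvd_mult_div_cancel power_mult power_one)
    then obtain j where "chi r = zeta M ^ j" using M0 root_of_unity_is_zeta_power by blast
    thus ?thesis using unital_subring_power[OF R zM] by simp
  next
    case False
    hence "chi r = 0" using dirichlet_char_nonzero_iff[OF that(2) q[OF that(1)]] by blast
    thus ?thesis using R by (simp add: unital_subring_def)
  qed
  have "\<forall>s\<in>S. c s = 0" if S: "finite S" "S \<subseteq> (\<Union>i\<in>I. X_odd (q i) (Suc n))"
    and c: "\<forall>s\<in>S. c s \<in> F" and rel: "(\<Sum>s\<in>S. c s * s) = 0" for S c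
  proof -
    have "\<forall>s\<in>S. \<exists>i chi. i \<in> I \<and> dirichlet_char (q i) chi \<and> odd_char (q i) chi \<and> s = dirichlet_L (Suc n) chi"
      using S(2) unfolding X_odd_def by blast
    \<comment> \<open>The relation is indexed by L-values, so one modulus and one character are
      chosen for each value.\<close>
    then obtain ix ch where ch: "\<And>s. s \<in> S \<Longrightarrow> ix s \<in> I" "\<And>s. s \<in> S \<Longrightarrow> dirichlet_char (q (ix s)) (ch s)"
      "\<And>s. s \<in> S \<Longrightarrow> odd_char (q (ix s)) (ch s)" "\<And>s. s \<in> S \<Longrightarrow> s = dirichlet_L (Suc n) (ch s)"
      by metis
    define Q where "Q = (\<lambda>s. q (ix s))"
    have Q2: "Q s > 2" and QN: "Q s dvd N" if "s \<in> S" for s using q qN ch that by (auto simp: Q_def)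
    define T where "T = (\<lambda>s x. \<Sum>r<Q s. ch s r * poly (L_poly n (Q s)) (x ^ r))"
    define C where "C = - ((\<i> * of_real pi) ^ Suc n / (2 * fact n :: complex))"
    have C: "C \<noteq> 0" by (simp add: C_def)
    have L: "s = C * T s (zeta (Q s))" if "s \<in> S" for s
      using dirichlet_L_odd[OF ch(2,3)[OF that] Q2[OF that, unfolded Q_def] n(1,2)] ch(4)[OF that]
      by (simp add: C_def T_def Q_def)
    have T_conj: "ch s b * T s (x ^ b) = T s x" if s: "s \<in> S" and x: "x ^ Q s = 1" and b: "coprime b (Q s)" for s x b
    proof -
      have "ch s b * (\<Sum>r<Q s. ch s r * poly (L_poly n (Q s)) (x ^ (b * r))) =
          (\<Sum>r<Q s. ch s r * poly (L_poly n (Q s)) (x ^ r))"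
        using ch(2)[OF s] Q2[OF s] b x
        by (intro dirichlet_char_sum_mult) (auto simp: power_mod_root_of_unity Q_def)
      thus ?thesis by (simp add: T_def power_mult)
    qed
    \<comment> \<open>Since \<open>zeta (Q s) = zeta N ^ (N div Q s)\<close>, the relation for all
      moduli becomes a single polynomial relation at \<open>zeta N\<close>.\<close>
    define P where "P = (\<Sum>s\<in>S. smult (c s) (\<Sum>r<Q s. smult (ch s r)
       (pcompose (L_poly n (Q s)) (Polynomial.monom 1 (N div Q s * r)))))"
    have polyP: "poly P x = (\<Sum>s\<in>S. c s * T s (x ^ (N div Q s)))" for x
      by (simp add: P_def poly_sum poly_pcompose poly_monom T_def power_mult)
    have "\<rat> \<subseteq> F" using int by blast
    hence "L_poly n (Q s) \<in> polys_over F" for s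
      using L_poly_polys_over_Rats polys_over_mono by blast
    moreover have "ch s r \<in> F" if "s \<in> S" for s r
      by (rule char_in_F[OF ch(1)[OF that] ch(2)[OF that]])
    ultimately have PF: "P \<in> polys_over F" unfolding P_def using c R
      by (intro polys_over_sum[OF R] polys_over_smult[OF R] polys_over_pcompose[OF R] polys_over_monom[OF R])
         (auto simp: unital_subring_def)
    have "C * poly P (zeta N) = (\<Sum>s\<in>S. c s * s)"
      unfolding polyP sum_distrib_left
    proof (intro sum.cong refl)
      fix s assume s: "s \<in> S"
      have "zeta N ^ (N div Q s) = zeta (Q s)" using zeta_power_div QN[OF s] N0 by blast
      thus "C * (c s * T s (zeta N ^ (N div Q s))) = c s * s" using L[OF s] by (metis mult.left_commute)
    qed
    hence Pz: "poly P (zeta N) = 0" using rel C by simp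
    \<comment> \<open>Inversion is the power \<open>Q s - 1\<close> on \<open>Q s\<close>-th roots
      of unity, and \<open>ch s\<close> is -1 there, so \<open>T_conj\<close> gives the
      sign.\<close>
    have Podd: "poly P (inverse x) = - poly P x" if x: "x ^ N = 1" for x
      unfolding polyP sum_negf[symmetric]
    proof (intro sum.cong refl)
      fix s assume s: "s \<in> S"
      define y where "y = x ^ (N div Q s)"
      have y: "y ^ Q s = 1" using x QN[OF s] by (simp add: y_def flip: power_mult)
      have "y * y ^ (Q s - 1) = 1" using y Q2[OF s] by (metis power_eq_if not_less0)
      hence "inverse y = y ^ (Q s - 1)" by (rule inverse_unique)
      moreover have "coprime (Q s - 1) (Q s)" using Q2[OF s] by (intro coprime_diff_one_left_nat) simp
      hence "ch s (Q s - 1) * T s (y ^ (Q s - 1)) = T s y" by (rule T_conj[OF s y])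
      ultimately have "- T s (inverse y) = T s y"
        using ch(3)[OF s] by (simp add: odd_char_def Q_def)
      hence "T s (inverse y) = - T s y" by (metis minus_minus)
      thus "c s * T s (inverse x ^ (N div Q s)) = - (c s * T s (x ^ (N div Q s)))"
        by (simp add: y_def power_inverse)
    qed
    have "\<forall>s\<in>S. c s * T s (zeta (Q s)) = 0"
    \<comment> \<open>By \<open>T_conj\<close>, passing from \<open>zeta N\<close> to its
      \<open>b\<close>-th power divides each \<open>T s\<close> by \<open>ch s b\<close>, hence the
      inverses; none of these values is 0 for \<open>b\<close> coprime to \<open>N\<close>.\<close>
    proof (rule linear_independence_of_characters[where \<phi> = "\<lambda>s b. inverse (ch s b)" and G = "{b. coprime b N}"])
      fix b assume "b \<in> {b. coprime b N}"
      hence b: "coprime b N" by simp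
      have "poly P (zeta N ^ b) = 0"
        by (rule odd_cyclotomic_conjugate[OF F N2 int PF Pz b Podd])
      moreover have "poly P (zeta N ^ b) = (\<Sum>s\<in>S. c s * T s (zeta (Q s)) * inverse (ch s b))"
        unfolding polyP
      proof (intro sum.cong refl)
        fix s assume s: "s \<in> S"
        have z: "zeta N ^ (N div Q s) = zeta (Q s)" using zeta_power_div QN[OF s] N0 by blast
        have bq: "coprime b (Q s)" using b QN[OF s] by (metis coprime_divisors dvd_refl)
        have "ch s b \<noteq> 0"
          using dirichlet_char_nonzero_iff[OF ch(2)[OF s]] Q2[OF s] bq by (simp add: Q_def)
        moreover have "ch s b * T s (zeta (Q s) ^ b) = T s (zeta (Q s))"
          using Q2[OF s] by (intro T_conj[OF s _ bq]) simp
        moreover have "(zeta N ^ b) ^ (N div Q s) = zeta (Q s) ^ b"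
          by (metis z power_mult mult.commute)
        ultimately show "c s * T s ((zeta N ^ b) ^ (N div Q s)) = c s * T s (zeta (Q s)) * inverse (ch s b)"
          by (simp add: field_simps)
      qed
      ultimately show "(\<Sum>s\<in>S. c s * T s (zeta (Q s)) * inverse (ch s b)) = 0" by simp
    next
      fix s t assume st: "s \<in> S" "t \<in> S" "s \<noteq> t"
      note lift = crt_coprime_lift[OF finI ch(1)[OF st(1)] cop, folded N_def]
      note cs = ch(2)[OF st(1)] Q2[OF st(1), unfolded Q_def] and ct = ch(2)[OF st(2)] Q2[OF st(2), unfolded Q_def]
      show "\<exists>b\<in>{b. coprime b N}. inverse (ch s b) \<noteq> inverse (ch t b)"
      \<comment> \<open>For equal moduli the distinct L-values force the characters to differ
        somewhere. For different moduli oddness separates them: take \<open>b\<close> to be -1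
        modulo the first and 1 modulo the second.\<close>
      proof (cases "ix s = ix t")
        case True
        have "ch s \<noteq> ch t" using ch(4) st by metis
        then obtain a where a: "ch s a \<noteq> ch t a" by blast
        \<comment> \<open>Otherwise both characters would vanish at \<open>a\<close>.\<close>
        have "coprime a (q (ix s))"
          using a dirichlet_char_nonzero_iff[OF cs, of a] dirichlet_char_nonzero_iff[OF ct, of a] True by auto
        from lift[OF this] obtain b where b: "coprime b N" "[b = a] (mod q (ix s))" by blast
        have "ch s b = ch s a" "ch t b = ch t a"
          using dirichlet_char_cong[OF cs b(2)] dirichlet_char_cong[OF ct] b(2) True by auto
        thus ?thesis using a b by auto
      next
        case False
        have "coprime (q (ix s) - 1) (q (ix s))" using cs by (intro coprime_diff_one_left_nat) simp
        from lift[OF this] obtain b where b: "coprime b N" "[b = q (ix s) - 1] (mod q (ix s))"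
          "[b = 1] (mod q (ix t))" using ch(1)[OF st(2)] False by auto
        have "ch s b = -1"
          using dirichlet_char_cong[OF cs b(2)] ch(3)[OF st(1)] by (simp add: odd_char_def)
        moreover have "ch t b = 1"
          using dirichlet_char_cong[OF ct b(3)] dirichlet_char_1[OF ct] by simp
        ultimately show ?thesis using b(1) by (intro bexI[of _ b]) auto
      qed
    next
      fix s assume s: "s \<in> S"
      note cs = ch(2)[OF s] Q2[OF s, unfolded Q_def]
      show "inverse (ch s 1) = 1" using dirichlet_char_1[OF cs] by simp
      show "inverse (ch s (a * b)) = inverse (ch s a) * inverse (ch s b)" for a b
        using dirichlet_char_mult[OF cs] by simp
    qed (use S(1) in auto)
    moreover have "T s (zeta (Q s)) \<noteq> 0" if s: "s \<in> S" for s
    proof -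
      have "s \<noteq> 0" using dirichlet_L_nonzero[OF ch(2)[OF s] Q2[OF s, unfolded Q_def] n(3)] ch(4)[OF s] by simp
      thus ?thesis using L[OF s] by auto
    qed
    ultimately show ?thesis by auto
  qed
  thus ?thesis unfolding lin_indep_over_def F_def M_def I_def n_def by auto
qed

end
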